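(* Let $G$ and $G'$ each be both a groupoid and a topological space (no compatibility assumed) with Hausdorff unit space and gradings $\mathsf{c}:G\to\Gamma$, $\mathsf{c}':G'\to\Gamma$ into the same groupoid $\Gamma$, and let $Y$ and $Y'$ be indecomposable semigroupoids. Let $A\subseteq{}_Y\mathcal{O}_\mathsf{h}(G)$ and $A'\subseteq{}_{Y'}\mathcal{O}_\mathsf{h}(G')$ be semigroups on which the product is given by $ab(gh)=a(g)b(h)$ (whenever this is defined) whenever $\mathrm{dom}(a)$ or $\mathrm{dom}(b)$ is a bisection. Let $Z,D,S,C,N\subseteq A$ and $Z',D',S',C',N'\subseteq A'$ be the subsets defined in the context. If (1) $\mathrm{dom}(ab)\subseteq\mathrm{dom}(a)\mathrm{dom}(b)$ whenever $a,b\in N$ or $a,b\in N'$, (2) $D$ and $D'$ are exhaustive, (3) $S$ and $S'$ are compact-bumpy, (4) $G$ and $G'$ are ample, (5) $C^{\mathsf{R}}_Z\subseteq S$ and $C'^{\mathsf{R}}_{Z'}\subseteq S'$, and (6) $A$ and $A'$ are diagonally isomorphic graded semigroups (there is a diagonal-preserving graded semigroup isomorphism $A\to A'$), then $G$ and $G'$ are isomorphic étale groupoids (i.e. there is a groupoid isomorphism $G\to G'$ that is a homeomorphism).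
   Context: For a groupoid $G$: $\mathsf{s}(g)=g^{-1}g$, $\mathsf{r}(g)=gg^{-1}$; $G^0$ is the set of units; $gh$ is defined iff $\mathsf{s}(g)=\mathsf{r}(h)$; for $X,X'\subseteq G$, $XX'=\{xx':x\in X,x'\in X',\mathsf{s}(x)=\mathsf{r}(x')\}$ and $X^{-1}=\{x^{-1}:x\in X\}$. $\mathcal{O}(G)$ is the topology; $\mathrm{int}$ denotes interior in $G$. A bisection is $B\subseteq G$ with $BB^{-1}\cup B^{-1}B\subseteq G^0$; $\mathcal{B}_\mathsf{c}(G)$ and $\mathcal{B}^\circ_\mathsf{c}(G)$ are the sets of compact and of compact open bisections. $G^{\mathrm{iso}}=\{g\in G:\mathsf{s}(g)=\mathsf{r}(g)\}$; an isosection is $I\subseteq G$ with $II^{-1}\cup I^{-1}I\subseteq G^{\mathrm{iso}}$. $G$ is étale if inversion and multiplication are continuous and $\mathsf{s}$ is a local homeomorphism onto an open subset of $G$. $G$ is ample if some $\mathcal{B}\subseteq\mathcal{B}^\circ_\mathsf{c}(G)$ is a basis for the topology closed under $(O,N)\mapsto ON$ and $O\mapsto O^{-1}$ (ample groupoids are étale). A grading $\mathsf{c}:G\to\Gamma$ is a map with $\mathsf{c}(xy)=\mathsf{c}(x)\mathsf{c}(y)$ (the right side being defined) whenever $xy$ is defined. $H\subseteq G$ is homogeneous if $\mathsf{c}$ is constant on $H$; $\mathcal{O}_\mathsf{h}(G)$ and $\mathcal{B}^\circ_\mathsf{h}(G)$ are the sets of homogeneous open subsets and homogeneous open bisections. A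 semigroupoid $Y$ is a set with a partial product that is associative: $x(yz)$ is defined iff $(xy)z$ is, in which case they are equal. A unit $1\in Y$ is an element with $1y$ and $y1$ defined and equal to $y$ for all $y$. $Y^\times$ is the set of $y$ having $y^{-1}\in Y$ with $yy^{-1}=1=y^{-1}y$. The centre $\mathsf{Z}(Y)$ is the set of $z\in Y$ such that, for all $y$, $yz$ is defined iff $zy$ is, in which case they are equal. $Y$ is indecomposable if it has a unit and $1$ is the only idempotent in $\mathsf{Z}(Y)$. For a family $\mathcal{X}$ of subsets of $G$, ${}_Y\mathcal{X}$ is the set of partial functions $a$ from $G$ to $Y$ with domain $\mathrm{dom}(a)\in\mathcal{X}$; $\mathrm{ran}(a)$ is the range; for $W\subseteq Y$, $[W]a=\{g\in\mathrm{dom}(a):a(g)\in W\}$, $[1]a=[\{1\}]a$. The assumption on $A$: it is a set of partial functions with homogeneous open domains carrying an (everywhere defined) associative product such that, whenever $\mathrm{dom}(a)$ or $\mathrm{dom}(b)$ is a bisection, $ab$ is the function given by $ab(gh)=a(g)b(h)$, with domain consisting of those $gh$ with $g\in\mathrm{dom}(a)$, $h\in\mathrm{dom}(b)$, $\mathsf{s}(g)=\mathsf{r}(h)$ and $a(g)b(h)$ defined in $Y$. (Nothing but associativity is assumed about other products.) Likewise for $A'$. Subsets of $A$ (and analogously primed subsets of $A'$): $Z=\{a\in A:\mathrm{dom}(a)\subseteq G^0,\ \mathrm{ran}(a)\subseteq\mathsf{Z}(Y)\}$; $D=\{a\in A:\mathrm{dom}(a)\subseteq G^0\}$; $S=\{a\in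 A:\mathrm{dom}(a)\text{ is a bisection}\}$; $C=\{a\in A:\mathrm{dom}(a)\subseteq G^{\mathrm{iso}}\}$; $N=\{a\in A:\mathrm{dom}(a)\text{ is an isosection}\}$; $C^{\mathsf{R}}_Z=\{c\in C:\exists c'\in C\ (cc',c'c\in Z,\ cc'c=c,\ c'cc'=c')\}$. $D$ is exhaustive if for all $g\in G^0$ and $y\in Y$ there is $d\in D$ with $d(g)=y$. $S\subseteq{}_Y\mathcal{B}^\circ_\mathsf{h}(G)$ is compact-bumpy if: (1-Proper) $[1]a$ is compact for all $a\in S$; (Urysohn) the empty function is in $S$, and whenever $g\in O\in\mathcal{O}(G)$ there is $a\in S$ with $\mathrm{dom}(a)\subseteq O$ and $g\in\mathrm{int}([Y^\times]a)$; (Involutive) whenever $a\in S$ and $g\in\mathrm{int}([Y^\times]a)$, there is $b\in S$ with $g^{-1}\in\mathrm{int}(\{h\in G:a(h^{-1})=b(h)^{-1}\})$; (Compact-Urysohn) for any homogeneous $K\in\mathcal{B}_\mathsf{c}(G)$ and $O\in\mathcal{B}^\circ_\mathsf{h}(G)$ with $K\subseteq O$ there is $a\in S$ with $\mathrm{dom}(a)\subseteq O$ and $K\subseteq[Y^\times]a$; (Compact-Involutive) if $a\in S$ and $K\subseteq[Y^\times]a$ is compact, there is $b\in S$ with $a(g)^{-1}=b(g^{-1})$ for all $g\in K$. For a nonempty function $a\in A$, $\mathsf{c}(a)\in\Gamma$ is the element with $\mathsf{c}[\mathrm{dom}(a)]=\{\mathsf{c}(a)\}$, and similarly $\mathsf{c}'$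 on $A'$. A semigroup isomorphism $\phi:A\to A'$ is graded if $\mathsf{c}(a)=\mathsf{c}'(\phi(a))$ for all $a\in A\setminus\{\emptyset\}$, and diagonal-preserving if $\phi[D]=D'$. *)

theory Defs
  imports "HOL-Analysis.Abstract_Topology" "HOL-Analysis.T1_Spaces" "HOL-Analysis.Product_Topology"
begin

section \<open>Groupoids\<close>

text \<open>The field \<open>gmult\<close> is a total HOL function; only its values on composable pairs
  \<open>src g = rng h\<close> of arrows, i.e. on the pairs whose product is defined, are meaningful.\<close>

record 'a groupoid =
  arrows :: "'a set"
  gmult :: "'a \<Rightarrow> 'a \<Rightarrow> 'a"
  ginv :: "'a \<Rightarrow> 'a"

definition src :: "('a, 'm) groupoid_scheme \<Rightarrow> 'a \<Rightarrow> 'a" where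
  "src G g = gmult G (ginv G g) g"

definition rng :: "('a, 'm) groupoid_scheme \<Rightarrow> 'a \<Rightarrow> 'a" where
  "rng G g = gmult G g (ginv G g)"

locale groupoid =
  fixes G :: "('a, 'm) groupoid_scheme"
  assumes ginv_closed: "g \<in> arrows G \<Longrightarrow> ginv G g \<in> arrows G"
    and src_ginv: "g \<in> arrows G \<Longrightarrow> src G (ginv G g) = rng G g"
    and rng_ginv: "g \<in> arrows G \<Longrightarrow> rng G (ginv G g) = src G g"
    and gmult_closed:
      "\<lbrakk>g \<in> arrows G; h \<in> arrows G; src G g = rng G h\<rbrakk> \<Longrightarrow> gmult G g h \<in> arrows G"
    and src_gmult:
      "\<lbrakk>g \<in> arrows G; h \<in> arrows G; src G g = rng G h\<rbrakk> \<Longrightarrow> src G (gmult G g h) = src G h"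
    and rng_gmult:
      "\<lbrakk>g \<in> arrows G; h \<in> arrows G; src G g = rng G h\<rbrakk> \<Longrightarrow> rng G (gmult G g h) = rng G g"
    and gmult_assoc:
      "\<lbrakk>g \<in> arrows G; h \<in> arrows G; k \<in> arrows G; src G g = rng G h; src G h = rng G k\<rbrakk>
        \<Longrightarrow> gmult G (gmult G g h) k = gmult G g (gmult G h k)"
    and gmult_src: "g \<in> arrows G \<Longrightarrow> gmult G g (src G g) = g"
    and gmult_rng: "g \<in> arrows G \<Longrightarrow> gmult G (rng G g) g = g"

definition units :: "('a, 'm) groupoid_scheme \<Rightarrow> 'a set" where
  "units G = {g \<in> arrows G. src G g = g}"

definition iso_arrows :: "('a, 'm) groupoid_scheme \<Rightarrow> 'a set" where
  "iso_arrows G = {g \<in> arrows G. src G g = rng G g}"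

definition set_gmult :: "('a, 'm) groupoid_scheme \<Rightarrow> 'a set \<Rightarrow> 'a set \<Rightarrow> 'a set" where
  "set_gmult G X X' = {gmult G x x' | x x'. x \<in> X \<and> x' \<in> X' \<and> src G x = rng G x'}"

definition set_ginv :: "('a, 'm) groupoid_scheme \<Rightarrow> 'a set \<Rightarrow> 'a set" where
  "set_ginv G X = ginv G ` X"

definition bisection :: "('a, 'm) groupoid_scheme \<Rightarrow> 'a set \<Rightarrow> bool" where
  "bisection G B \<longleftrightarrow> B \<subseteq> arrows G \<and>
     set_gmult G B (set_ginv G B) \<union> set_gmult G (set_ginv G B) B \<subseteq> units G"

definition isosection :: "('a, 'm) groupoid_scheme \<Rightarrow> 'a set \<Rightarrow> bool" where
  "isosection G I \<longleftrightarrow> I \<subseteq> arrows G \<and>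
     set_gmult G I (set_ginv G I) \<union> set_gmult G (set_ginv G I) I \<subseteq> iso_arrows G"

definition grading ::
  "('a, 'm) groupoid_scheme \<Rightarrow> ('k, 'n) groupoid_scheme \<Rightarrow> ('a \<Rightarrow> 'k) \<Rightarrow> bool" where
  "grading G \<Gamma> c \<longleftrightarrow> c ` arrows G \<subseteq> arrows \<Gamma> \<and>
     (\<forall>x\<in>arrows G. \<forall>y\<in>arrows G. src G x = rng G y \<longrightarrow>
        src \<Gamma> (c x) = rng \<Gamma> (c y) \<and> c (gmult G x y) = gmult \<Gamma> (c x) (c y))"

definition groupoid_iso ::
  "('a, 'm) groupoid_scheme \<Rightarrow> ('b, 'n) groupoid_scheme \<Rightarrow> ('a \<Rightarrow> 'b) \<Rightarrow> bool" where
  "groupoid_iso G G' \<psi> \<longleftrightarrow> bij_betw \<psi> (arrows G) (arrows G') \<and>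
     (\<forall>g\<in>arrows G. \<forall>h\<in>arrows G.
        (src G g = rng G h \<longleftrightarrow> src G' (\<psi> g) = rng G' (\<psi> h)) \<and>
        (src G g = rng G h \<longrightarrow> \<psi> (gmult G g h) = gmult G' (\<psi> g) (\<psi> h)))"


section \<open>Groupoids carrying a topology\<close>

record 'a top_groupoid = "'a groupoid" +
  gtop :: "'a topology"

text \<open>No compatibility between the algebraic structure and the topology is required here.\<close>

locale top_groupoid = groupoid G for G :: "'a top_groupoid" +
  assumes topspace_gtop: "topspace (gtop G) = arrows G"

definition local_homeomorphism :: "'a topology \<Rightarrow> 'b topology \<Rightarrow> ('a \<Rightarrow> 'b) \<Rightarrow> bool" where
  "local_homeomorphism T T' f \<longleftrightarrow>
     (\<forall>x\<in>topspace T. \<exists>U. x \<in> U \<and> openin T U \<and> openin T' (f ` U) \<and>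
        homeomorphic_map (subtopology T U) (subtopology T' (f ` U)) f)"

definition etale :: "'a top_groupoid \<Rightarrow> bool" where
  "etale G \<longleftrightarrow>
     continuous_map (gtop G) (gtop G) (ginv G) \<and>
     continuous_map
       (subtopology (prod_topology (gtop G) (gtop G))
          {(g, h). g \<in> arrows G \<and> h \<in> arrows G \<and> src G g = rng G h})
       (gtop G) (\<lambda>(g, h). gmult G g h) \<and>
     openin (gtop G) (src G ` arrows G) \<and>
     local_homeomorphism (gtop G) (subtopology (gtop G) (src G ` arrows G)) (src G)"

definition compact_open_bisections :: "'a top_groupoid \<Rightarrow> 'a set set" where
  "compact_open_bisections G = {B. bisection G B \<and> compactin (gtop G) B \<and> openin (gtop G) B}"

definition ample :: "'a top_groupoid \<Rightarrow> bool" where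
  "ample G \<longleftrightarrow> (\<exists>\<B> \<subseteq> compact_open_bisections G.
     openin (gtop G) = arbitrary union_of (\<lambda>B. B \<in> \<B>) \<and>
     (\<forall>U\<in>\<B>. \<forall>N\<in>\<B>. set_gmult G U N \<in> \<B>) \<and>
     (\<forall>U\<in>\<B>. set_ginv G U \<in> \<B>))"


section \<open>Semigroupoids\<close>

record 'y semigroupoid =
  elts :: "'y set"
  pmult :: "'y \<Rightarrow> 'y \<Rightarrow> 'y option"

text \<open>In \<open>pmult_assoc\<close>, equality of options says that one side is defined iff the other is,
  in which case they are equal; similarly in the definition of the centre.\<close>

locale semigroupoid =
  fixes Y :: "'y semigroupoid"
  assumes pmult_closed: "\<lbrakk>x \<in> elts Y; y \<in> elts Y; pmult Y x y = Some z\<rbrakk> \<Longrightarrow> z \<in> elts Y"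
    and pmult_assoc: "\<lbrakk>x \<in> elts Y; y \<in> elts Y; z \<in> elts Y\<rbrakk> \<Longrightarrow>
      Option.bind (pmult Y y z) (\<lambda>t. pmult Y x t) = Option.bind (pmult Y x y) (\<lambda>t. pmult Y t z)"

definition is_sunit :: "'y semigroupoid \<Rightarrow> 'y \<Rightarrow> bool" where
  "is_sunit Y e \<longleftrightarrow> e \<in> elts Y \<and> (\<forall>y\<in>elts Y. pmult Y e y = Some y \<and> pmult Y y e = Some y)"

definition sone :: "'y semigroupoid \<Rightarrow> 'y" where
  "sone Y = (THE e. is_sunit Y e)"

definition is_sinverse :: "'y semigroupoid \<Rightarrow> 'y \<Rightarrow> 'y \<Rightarrow> bool" where
  "is_sinverse Y y x \<longleftrightarrow> x \<in> elts Y \<and> pmult Y y x = Some (sone Y) \<and> pmult Y x y = Some (sone Y)"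

definition sinvertibles :: "'y semigroupoid \<Rightarrow> 'y set" where
  "sinvertibles Y = {y \<in> elts Y. \<exists>x. is_sinverse Y y x}"

definition sinv :: "'y semigroupoid \<Rightarrow> 'y \<Rightarrow> 'y" where
  "sinv Y y = (THE x. is_sinverse Y y x)"

definition scentre :: "'y semigroupoid \<Rightarrow> 'y set" where
  "scentre Y = {z \<in> elts Y. \<forall>y\<in>elts Y. pmult Y y z = pmult Y z y}"

locale indecomposable_semigroupoid = semigroupoid +
  assumes ex_sunit: "\<exists>e. is_sunit Y e"
    and central_idempotents: "{z \<in> scentre Y. pmult Y z z = Some z} = {sone Y}"


section \<open>Semigroups of partial functions\<close>

text \<open>\<open>is_convolution G Y a b ab\<close>: \<open>ab\<close> is the partial function with \<open>ab (g h) = a g \<cdot> b h\<close>,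
  with domain consisting precisely of those \<open>g h\<close> for which the right hand side is defined.\<close>

definition is_convolution :: "'a top_groupoid \<Rightarrow> 'y semigroupoid \<Rightarrow>
    ('a \<rightharpoonup> 'y) \<Rightarrow> ('a \<rightharpoonup> 'y) \<Rightarrow> ('a \<rightharpoonup> 'y) \<Rightarrow> bool" where
  "is_convolution G Y a b ab \<longleftrightarrow> (\<forall>k y. ab k = Some y \<longleftrightarrow>
     (\<exists>g h u v. a g = Some u \<and> b h = Some v \<and> src G g = rng G h \<and>
        k = gmult G g h \<and> pmult Y u v = Some y))"

locale pfun_semigroup =
  fixes G :: "'a top_groupoid" and c :: "'a \<Rightarrow> 'k" and Y :: "'y semigroupoid"
    and A :: "('a \<rightharpoonup> 'y) set" and m :: "('a \<rightharpoonup> 'y) \<Rightarrow> ('a \<rightharpoonup> 'y) \<Rightarrow> ('a \<rightharpoonup> 'y)"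
  assumes ran_elts: "a \<in> A \<Longrightarrow> ran a \<subseteq> elts Y"
    and dom_open: "a \<in> A \<Longrightarrow> openin (gtop G) (dom a)"
    and dom_homogeneous: "a \<in> A \<Longrightarrow> c constant_on dom a"
    and m_closed: "\<lbrakk>a \<in> A; b \<in> A\<rbrakk> \<Longrightarrow> m a b \<in> A"
    and m_assoc: "\<lbrakk>a \<in> A; b \<in> A; d \<in> A\<rbrakk> \<Longrightarrow> m (m a b) d = m a (m b d)"
    and m_convolution: "\<lbrakk>a \<in> A; b \<in> A; bisection G (dom a) \<or> bisection G (dom b)\<rbrakk>
      \<Longrightarrow> is_convolution G Y a b (m a b)"

definition preim :: "'y set \<Rightarrow> ('a \<rightharpoonup> 'y) \<Rightarrow> 'a set" where
  "preim W a = {g \<in> dom a. the (a g) \<in> W}"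

definition Z_of :: "'a top_groupoid \<Rightarrow> 'y semigroupoid \<Rightarrow> ('a \<rightharpoonup> 'y) set \<Rightarrow> ('a \<rightharpoonup> 'y) set" where
  "Z_of G Y A = {a \<in> A. dom a \<subseteq> units G \<and> ran a \<subseteq> scentre Y}"

definition D_of :: "'a top_groupoid \<Rightarrow> ('a \<rightharpoonup> 'y) set \<Rightarrow> ('a \<rightharpoonup> 'y) set" where
  "D_of G A = {a \<in> A. dom a \<subseteq> units G}"

definition S_of :: "'a top_groupoid \<Rightarrow> ('a \<rightharpoonup> 'y) set \<Rightarrow> ('a \<rightharpoonup> 'y) set" where
  "S_of G A = {a \<in> A. bisection G (dom a)}"

definition C_of :: "'a top_groupoid \<Rightarrow> ('a \<rightharpoonup> 'y) set \<Rightarrow> ('a \<rightharpoonup> 'y) set" where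
  "C_of G A = {a \<in> A. dom a \<subseteq> iso_arrows G}"

definition N_of :: "'a top_groupoid \<Rightarrow> ('a \<rightharpoonup> 'y) set \<Rightarrow> ('a \<rightharpoonup> 'y) set" where
  "N_of G A = {a \<in> A. isosection G (dom a)}"

definition CRZ_of :: "'a top_groupoid \<Rightarrow> 'y semigroupoid \<Rightarrow> ('a \<rightharpoonup> 'y) set \<Rightarrow>
    (('a \<rightharpoonup> 'y) \<Rightarrow> ('a \<rightharpoonup> 'y) \<Rightarrow> ('a \<rightharpoonup> 'y)) \<Rightarrow> ('a \<rightharpoonup> 'y) set" where
  "CRZ_of G Y A m = {a \<in> C_of G A. \<exists>a'\<in>C_of G A.
     m a a' \<in> Z_of G Y A \<and> m a' a \<in> Z_of G Y A \<and> m (m a a') a = a \<and> m (m a' a) a' = a'}"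

definition exhaustive ::
  "'a top_groupoid \<Rightarrow> 'y semigroupoid \<Rightarrow> ('a \<rightharpoonup> 'y) set \<Rightarrow> bool" where
  "exhaustive G Y D \<longleftrightarrow> (\<forall>g\<in>units G. \<forall>y\<in>elts Y. \<exists>d\<in>D. d g = Some y)"

text \<open>An equation between partially defined expressions, such as \<open>a (h\<inverse>) = b (h)\<inverse>\<close>, asserts in
  particular that both sides are defined.\<close>

definition compact_bumpy :: "'a top_groupoid \<Rightarrow> ('a \<Rightarrow> 'k) \<Rightarrow> 'y semigroupoid \<Rightarrow>
    ('a \<rightharpoonup> 'y) set \<Rightarrow> bool" where
  "compact_bumpy G c Y S \<longleftrightarrow>
     \<comment> \<open>ambient family: values in \<open>Y\<close>, domains homogeneous open bisections\<close>
     (\<forall>a\<in>S. ran a \<subseteq> elts Y \<and> openin (gtop G) (dom a) \<and> bisection G (dom a) \<and> c constant_on dom a) \<and>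
     \<comment> \<open>1-Proper\<close>
     (\<forall>a\<in>S. compactin (gtop G) (preim {sone Y} a)) \<and>
     \<comment> \<open>Urysohn\<close>
     Map.empty \<in> S \<and>
     (\<forall>U g. openin (gtop G) U \<and> g \<in> U \<longrightarrow>
        (\<exists>a\<in>S. dom a \<subseteq> U \<and> g \<in> gtop G interior_of preim (sinvertibles Y) a)) \<and>
     \<comment> \<open>Involutive\<close>
     (\<forall>a\<in>S. \<forall>g \<in> gtop G interior_of preim (sinvertibles Y) a.
        \<exists>b\<in>S. ginv G g \<in> gtop G interior_of
          {h \<in> arrows G. \<exists>y\<in>sinvertibles Y. b h = Some y \<and> a (ginv G h) = Some (sinv Y y)}) \<and>
     \<comment> \<open>Compact-Urysohn\<close>
     (\<forall>K U. compactin (gtop G) K \<and> bisection G K \<and> c constant_on K \<and>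
        openin (gtop G) U \<and> bisection G U \<and> c constant_on U \<and> K \<subseteq> U \<longrightarrow>
        (\<exists>a\<in>S. dom a \<subseteq> U \<and> K \<subseteq> preim (sinvertibles Y) a)) \<and>
     \<comment> \<open>Compact-Involutive\<close>
     (\<forall>a\<in>S. \<forall>K. compactin (gtop G) K \<and> K \<subseteq> preim (sinvertibles Y) a \<longrightarrow>
        (\<exists>b\<in>S. \<forall>g\<in>K. b (ginv G g) = Some (sinv Y (the (a g)))))"

text \<open>Only meaningful for nonempty \<open>a\<close> with homogeneous domain.\<close>

definition degree_of :: "('a \<Rightarrow> 'k) \<Rightarrow> ('a \<rightharpoonup> 'y) \<Rightarrow> 'k" where
  "degree_of c a = (THE \<gamma>. c ` dom a = {\<gamma>})"

definition semigroup_iso :: "'x set \<Rightarrow> ('x \<Rightarrow> 'x \<Rightarrow> 'x) \<Rightarrow> 'z set \<Rightarrow> ('z \<Rightarrow> 'z \<Rightarrow> 'z) \<Rightarrow>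
    ('x \<Rightarrow> 'z) \<Rightarrow> bool" where
  "semigroup_iso A m A' m' \<phi> \<longleftrightarrow>
     bij_betw \<phi> A A' \<and> (\<forall>a\<in>A. \<forall>b\<in>A. \<phi> (m a b) = m' (\<phi> a) (\<phi> b))"

definition graded_map :: "('a \<Rightarrow> 'k) \<Rightarrow> ('b \<Rightarrow> 'k) \<Rightarrow> ('a \<rightharpoonup> 'y) set \<Rightarrow>
    (('a \<rightharpoonup> 'y) \<Rightarrow> ('b \<rightharpoonup> 'z)) \<Rightarrow> bool" where
  "graded_map c c' A \<phi> \<longleftrightarrow> (\<forall>a \<in> A - {Map.empty}. degree_of c a = degree_of c' (\<phi> a))"

end

theory Submission
  imports Defs
begin

text \<open>
  The groupoid is recovered from the product of \<open>A\<close> and the subset \<open>D\<close> alone.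

  Let \<open>E\<close> be the set of idempotents of \<open>D\<close> that commute with \<open>D\<close>. Since \<open>D\<close> is exhaustive, their
  values are central idempotents of \<open>Y\<close>, hence equal to \<open>1\<close>, and 1-Properness makes their domains
  compact. So \<open>E\<close> consists of characteristic functions of compact open sets of units (\<open>E_iff\<close>,
  \<open>E_compact\<close>), and as the unit space is Hausdorff it separates units.

  Call \<open>a\<close> a regular normalizer if it has a generalised inverse \<open>a'\<close> such that \<open>E\<close> contains
  \<open>aa'\<close>, \<open>a'a\<close>, \<open>aEa'\<close> and \<open>a'Ea\<close>. This refers only to \<open>A\<close> as a semigroup and to \<open>D\<close>, so it is
  preserved by diagonal isomorphisms. The key point is that the domain of a regular normalizer is a
  bisection (\<open>R_bisection\<close>). Normalizing \<open>E\<close> makes it an isosection, because \<open>E\<close> separates units.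
  If \<open>t'\<close> inverts a section \<open>t\<close> defined near an arrow of \<open>dom a\<close>, then \<open>t'a\<close> lives on the isotropy
  and has a generalised inverse modulo \<open>Z\<close> there, so by assumption its domain is a bisection;
  translating back, \<open>a\<close> is defined at only one arrow with the given range. Consequently the regular
  normalizers are the elements of \<open>A\<close> that live on a bisection and have a pointwise inverse in \<open>A\<close>.
  Their domains are compact open, and by ampleness and compact-bumpiness these domains form a basis
  of the topology.

  Now let \<open>\<phi>\<close> be a diagonal isomorphism. Between regular normalizers, \<open>dom a \<subseteq> dom b\<close> just means
  \<open>a \<in> Db\<close>, so \<open>\<phi>\<close> respects inclusion of domains. For an arrow \<open>g\<close>, the sets \<open>dom (\<phi> a)\<close>, with \<open>a\<close>
  ranging over the regular normalizers defined at \<open>g\<close>, therefore form a downward directed family of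
  nonempty compact sets, and they have a common point \<open>g'\<close>. Since regular normalizers separate
  arrows, \<open>g'\<close> is unique and is characterised by \<open>g \<in> dom a \<longleftrightarrow> g' \<in> dom (\<phi> a)\<close>. The bijection
  \<open>g \<mapsto> g'\<close> matches a basis with a basis, so it is a homeomorphism. It respects composability and
  products because \<open>dom (ab) = dom a dom b\<close> for regular normalizers.
\<close>

section \<open>Groupoids\<close>

context groupoid
begin

lemma ginv_gmult: "gmult G (ginv G g) g = src G g"
  by (simp add: src_def)

lemma gmult_ginv: "gmult G g (ginv G g) = rng G g"
  by (simp add: rng_def)

lemma src_closed: "g \<in> arrows G \<Longrightarrow> src G g \<in> arrows G"
  using gmult_closed[of "ginv G g" g] by (simp add: ginv_closed src_ginv ginv_gmult)

lemma rng_closed: "g \<in> arrows G \<Longrightarrow> rng G g \<in> arrows G"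
  using src_closed[of "ginv G g"] by (simp add: ginv_closed src_ginv)

lemma src_src: "g \<in> arrows G \<Longrightarrow> src G (src G g) = src G g"
  using src_gmult[of "ginv G g" g] by (simp add: ginv_closed src_ginv ginv_gmult)

lemma rng_src: "g \<in> arrows G \<Longrightarrow> rng G (src G g) = src G g"
  using rng_gmult[of "ginv G g" g] by (simp add: ginv_closed src_ginv rng_ginv ginv_gmult)

lemma src_rng: "g \<in> arrows G \<Longrightarrow> src G (rng G g) = rng G g"
  using src_src[of "ginv G g"] by (simp add: ginv_closed src_ginv)

lemma rng_rng: "g \<in> arrows G \<Longrightarrow> rng G (rng G g) = rng G g"
  using rng_src[of "ginv G g"] by (simp add: ginv_closed src_ginv)

lemma ginv_gmult_cancel:
  assumes "g \<in> arrows G" "h \<in> arrows G" "rng G g = rng G h"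
  shows "gmult G (ginv G g) h \<in> arrows G" "src G (gmult G (ginv G g) h) = src G h"
    "rng G (gmult G (ginv G g) h) = src G g" "gmult G g (gmult G (ginv G g) h) = h"
proof -
  have s: "src G (ginv G g) = rng G h" "ginv G g \<in> arrows G"
    using assms by (simp_all add: src_ginv ginv_closed)
  show "gmult G (ginv G g) h \<in> arrows G" "src G (gmult G (ginv G g) h) = src G h"
    "rng G (gmult G (ginv G g) h) = src G g"
    using s assms by (simp_all add: gmult_closed src_gmult rng_gmult rng_ginv)
  have "gmult G (gmult G g (ginv G g)) h = gmult G g (gmult G (ginv G g) h)"
    by (rule gmult_assoc) (use s assms in \<open>simp_all add: rng_ginv\<close>)
  then show "gmult G g (gmult G (ginv G g) h) = h"
    using assms by (simp add: gmult_ginv gmult_rng)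
qed

lemma gmult_ginv_cancel:
  assumes "g \<in> arrows G" "h \<in> arrows G" "src G g = rng G h"
  shows "gmult G (gmult G g h) (ginv G h) = g"
  using assms gmult_assoc[of g h "ginv G h"] gmult_src[of g]
  by (simp add: ginv_closed rng_ginv gmult_ginv)

lemma ginv_ginv: assumes "g \<in> arrows G" shows "ginv G (ginv G g) = g"
proof -
  have "gmult G (gmult G (ginv G (ginv G g)) (ginv G g)) g
      = gmult G (ginv G (ginv G g)) (gmult G (ginv G g) g)"
    by (rule gmult_assoc) (use assms in \<open>simp_all add: ginv_closed src_ginv rng_ginv\<close>)
  then show ?thesis
    using assms gmult_src[of "ginv G (ginv G g)"]
    by (simp add: ginv_gmult src_ginv rng_ginv ginv_closed gmult_rng)
qed

lemma units_iff: "u \<in> units G \<longleftrightarrow> u \<in> arrows G \<and> src G u = u \<and> rng G u = u"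
  unfolding units_def using rng_src by force

lemma src_in_units: "g \<in> arrows G \<Longrightarrow> src G g \<in> units G"
  by (simp add: units_iff src_closed src_src rng_src)

lemma rng_in_units: "g \<in> arrows G \<Longrightarrow> rng G g \<in> units G"
  by (simp add: units_iff rng_closed src_rng rng_rng)

lemma src_image_arrows: "src G ` arrows G = units G"
  using src_in_units by (force simp: units_iff)

lemma gmult_unit_left: "\<lbrakk>u \<in> units G; h \<in> arrows G; src G u = rng G h\<rbrakk> \<Longrightarrow> gmult G u h = h"
  by (metis units_iff gmult_rng)

lemma gmult_unit_right: "\<lbrakk>u \<in> units G; h \<in> arrows G; src G h = rng G u\<rbrakk> \<Longrightarrow> gmult G h u = h"
  by (metis units_iff gmult_src)

text \<open>If \<open>src x = src y\<close>, then \<open>x y\<inverse>\<close> is defined, and it is a unit exactly when \<open>x = y\<close>;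
  dually for ranges.\<close>

lemma bisection_iff:
  "bisection G B \<longleftrightarrow> B \<subseteq> arrows G \<and> inj_on (src G) B \<and> inj_on (rng G) B" (is "?L \<longleftrightarrow> ?R")
proof
  assume L: ?L
  then have B: "B \<subseteq> arrows G" by (simp add: bisection_def)
  have "x = y" if xy: "x \<in> B" "y \<in> B" "src G x = src G y" for x y
  proof -
    have arr: "x \<in> arrows G" "y \<in> arrows G" using xy B by auto
    have c: "src G x = rng G (ginv G y)" using xy arr by (simp add: rng_ginv)
    have "gmult G x (ginv G y) \<in> set_gmult G B (set_ginv G B)"
      using xy c unfolding set_gmult_def set_ginv_def by blast
    then have u: "gmult G x (ginv G y) \<in> units G" using L by (auto simp: bisection_def)
    have "gmult G (gmult G x (ginv G y)) y = x"
      using gmult_ginv_cancel[of x "ginv G y"] arr c by (simp add: ginv_closed ginv_ginv)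
    moreover have "gmult G (gmult G x (ginv G y)) y = y"
      by (rule gmult_unit_left) (use u arr c in \<open>simp_all add: src_gmult ginv_closed src_ginv\<close>)
    ultimately show "x = y" by simp
  qed
  moreover have "x = y" if xy: "x \<in> B" "y \<in> B" "rng G x = rng G y" for x y
  proof -
    have arr: "x \<in> arrows G" "y \<in> arrows G" using xy B by auto
    have c: "src G (ginv G x) = rng G y" using xy arr by (simp add: src_ginv)
    have "gmult G (ginv G x) y \<in> set_gmult G (set_ginv G B) B"
      using xy c unfolding set_gmult_def set_ginv_def by blast
    then have u: "gmult G (ginv G x) y \<in> units G" using L by (auto simp: bisection_def)
    have "gmult G x (gmult G (ginv G x) y) = y"
      using ginv_gmult_cancel[of x y] arr xy by simp
    moreover have "gmult G x (gmult G (ginv G x) y) = x"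
      by (rule gmult_unit_right) (use u arr c in \<open>simp_all add: rng_gmult ginv_closed rng_ginv\<close>)
    ultimately show "x = y" by simp
  qed
  ultimately show ?R using B by (auto simp: inj_on_def)
next
  assume R: ?R
  have "set_gmult G B (set_ginv G B) \<subseteq> units G"
  proof
    fix k assume "k \<in> set_gmult G B (set_ginv G B)"
    then obtain x y where xy: "x \<in> B" "y \<in> B" "k = gmult G x (ginv G y)"
      "src G x = rng G (ginv G y)" unfolding set_gmult_def set_ginv_def by blast
    then have "x = y" using R by (auto simp: inj_on_def rng_ginv subset_iff)
    then show "k \<in> units G" using xy R by (auto simp: gmult_ginv rng_in_units)
  qed
  moreover have "set_gmult G (set_ginv G B) B \<subseteq> units G"
  proof
    fix k assume "k \<in> set_gmult G (set_ginv G B) B"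
    then obtain x y where xy: "x \<in> B" "y \<in> B" "k = gmult G (ginv G x) y"
      "src G (ginv G x) = rng G y" unfolding set_gmult_def set_ginv_def by blast
    then have "x = y" using R by (auto simp: inj_on_def src_ginv subset_iff)
    then show "k \<in> units G" using xy R by (auto simp: ginv_gmult src_in_units)
  qed
  ultimately show ?L using R by (simp add: bisection_def)
qed

lemma bisection_srcD: "\<lbrakk>bisection G B; g \<in> B; h \<in> B; src G g = src G h\<rbrakk> \<Longrightarrow> g = h"
  by (auto simp: bisection_iff inj_on_def)

lemma bisection_rngD: "\<lbrakk>bisection G B; g \<in> B; h \<in> B; rng G g = rng G h\<rbrakk> \<Longrightarrow> g = h"
  by (auto simp: bisection_iff inj_on_def)

lemma bisection_subset_units: "B \<subseteq> units G \<Longrightarrow> bisection G B"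
  unfolding bisection_iff inj_on_def by (metis subset_iff units_iff)

lemma set_gmult_iff:
  "k \<in> set_gmult G X X' \<longleftrightarrow> (\<exists>x\<in>X. \<exists>x'\<in>X'. src G x = rng G x' \<and> k = gmult G x x')"
  unfolding set_gmult_def by blast

end


section \<open>Ample groupoids are etale\<close>

locale ample_groupoid = top_groupoid +
  assumes ample: "ample G"
begin

abbreviation "T \<equiv> gtop G"

definition base :: "'a set set" where
  "base = (SOME \<B>. \<B> \<subseteq> compact_open_bisections G \<and>
     openin T = arbitrary union_of (\<lambda>B. B \<in> \<B>) \<and>
     (\<forall>U\<in>\<B>. \<forall>N\<in>\<B>. set_gmult G U N \<in> \<B>) \<and> (\<forall>U\<in>\<B>. set_ginv G U \<in> \<B>))"

lemma base_props: "base \<subseteq> compact_open_bisections G \<and>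
     openin T = arbitrary union_of (\<lambda>B. B \<in> base) \<and>
     (\<forall>U\<in>base. \<forall>N\<in>base. set_gmult G U N \<in> base) \<and> (\<forall>U\<in>base. set_ginv G U \<in> base)"
  unfolding base_def by (rule someI_ex) (use ample in \<open>simp add: ample_def\<close>)

lemma base_bisection: "B \<in> base \<Longrightarrow> bisection G B"
  and base_compact: "B \<in> base \<Longrightarrow> compactin T B"
  and base_open: "B \<in> base \<Longrightarrow> openin T B"
  and base_gmult: "\<lbrakk>B \<in> base; B' \<in> base\<rbrakk> \<Longrightarrow> set_gmult G B B' \<in> base"
  and base_ginv: "B \<in> base \<Longrightarrow> ginv G ` B \<in> base"
  using base_props by (auto simp: compact_open_bisections_def set_ginv_def)

lemma base_arrows: "\<lbrakk>B \<in> base; g \<in> B\<rbrakk> \<Longrightarrow> g \<in> arrows G"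
  using base_bisection by (auto simp: bisection_iff)

lemma base_nhd: assumes "openin T U" "g \<in> U" obtains B where "B \<in> base" "g \<in> B" "B \<subseteq> U"
proof -
  have "(arbitrary union_of (\<lambda>B. B \<in> base)) U" using assms base_props by simp
  then show thesis using that assms(2) unfolding arbitrary_union_of_alt by blast
qed

lemma openin_arrows: "openin T U \<Longrightarrow> U \<subseteq> arrows G"
  using openin_subset topspace_gtop by blast

lemma open_arrows: "openin T (arrows G)"
  using openin_topspace[of T] by (simp add: topspace_gtop)

lemma openin_nhdI:
  assumes "\<And>g. g \<in> U \<Longrightarrow> \<exists>B. openin T B \<and> g \<in> B \<and> B \<subseteq> U"
  shows "openin T U"
  using assms by (subst openin_subopen) blast

text \<open>On a bisection \<open>B\<close>, composability in \<open>B\<inverse> B\<close> forces the two factors to come from the same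
  arrow, so the sources of \<open>B\<close> form the basic set \<open>B\<inverse> B\<close>.\<close>

lemma open_src_image: assumes "openin T U" shows "openin T (src G ` U)"
proof (rule openin_nhdI)
  fix u assume "u \<in> src G ` U"
  then obtain g where g: "g \<in> U" "u = src G g" by blast
  then obtain B where B: "B \<in> base" "g \<in> B" "B \<subseteq> U" using base_nhd assms by blast
  have "set_gmult G (ginv G ` B) B = src G ` B"
  proof (intro equalityI subsetI)
    fix k assume "k \<in> set_gmult G (ginv G ` B) B"
    then obtain x y where xy: "x \<in> B" "y \<in> B" "src G (ginv G x) = rng G y"
      "k = gmult G (ginv G x) y" by (auto simp: set_gmult_iff)
    then have "rng G x = rng G y" using base_arrows[OF B(1)] by (simp add: src_ginv)
    then have "x = y" using bisection_rngD[OF base_bisection[OF B(1)]] xy by blast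
    then show "k \<in> src G ` B" using xy by (simp add: ginv_gmult)
  next
    fix k assume "k \<in> src G ` B"
    then obtain x where "x \<in> B" "k = gmult G (ginv G x) x" by (auto simp: src_def)
    then show "k \<in> set_gmult G (ginv G ` B) B"
      using base_arrows B src_ginv by (auto simp: set_gmult_iff)
  qed
  then have "openin T (src G ` B)" using base_gmult base_ginv base_open B by metis
  then show "\<exists>B. openin T B \<and> u \<in> B \<and> B \<subseteq> src G ` U" using B g by blast
qed

lemma open_units: "openin T (units G)"
  using open_src_image[OF open_arrows] by (simp add: src_image_arrows)

lemma open_ginv_image: assumes "openin T U" shows "openin T (ginv G ` U)"
proof (rule openin_nhdI)
  fix k assume "k \<in> ginv G ` U"
  then obtain g where g: "g \<in> U" "k = ginv G g" by blast
  then obtain B where B: "B \<in> base" "g \<in> B" "B \<subseteq> U" using base_nhd assms by blast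
  then show "\<exists>B. openin T B \<and> k \<in> B \<and> B \<subseteq> ginv G ` U"
    using g base_open[OF base_ginv[OF B(1)]] by blast
qed

lemma continuous_ginv: "continuous_map T T (ginv G)"
proof -
  have "{g \<in> arrows G. ginv G g \<in> U} = ginv G ` U" if "openin T U" for U
    using openin_arrows[OF that]
    by (auto simp: ginv_ginv ginv_closed subset_iff image_iff) (metis ginv_ginv)
  then show ?thesis
    unfolding continuous_map topspace_gtop using open_ginv_image ginv_closed by auto
qed

text \<open>If \<open>W \<subseteq> U\<close> is a set of units and \<open>B\<close> any set, then \<open>BW\<close> is the set of arrows of \<open>B\<close>
  with source in \<open>W\<close>. So openness of preimages under \<open>src\<close> reduces to openness of products of
  basic sets.\<close>

lemma open_src_vimage: assumes "openin T U" shows "openin T {g \<in> arrows G. src G g \<in> U}"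
proof (rule openin_nhdI)
  fix g assume g: "g \<in> {g \<in> arrows G. src G g \<in> U}"
  have "openin T (U \<inter> units G)" using assms open_units by auto
  then obtain W where W: "W \<in> base" "src G g \<in> W" "W \<subseteq> U \<inter> units G"
    using g src_in_units base_nhd by blast
  obtain B where B: "B \<in> base" "g \<in> B" using g base_nhd open_arrows by blast
  have "gmult G g (src G g) \<in> set_gmult G B W"
    using W B g rng_src unfolding set_gmult_iff by force
  then have "g \<in> set_gmult G B W" using g by (simp add: gmult_src)
  moreover have "set_gmult G B W \<subseteq> {g \<in> arrows G. src G g \<in> U}"
  proof
    fix k assume "k \<in> set_gmult G B W"
    then obtain b w where bw: "b \<in> B" "w \<in> W" "src G b = rng G w" "k = gmult G b w"
      by (auto simp: set_gmult_iff)
    then have "b \<in> arrows G" "w \<in> units G" "w \<in> U" using W B base_arrows by blast+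
    then have "k = b" "src G k = w" using bw gmult_unit_right[of w b] by (auto simp: units_iff)
    then show "k \<in> {g \<in> arrows G. src G g \<in> U}" using \<open>b \<in> arrows G\<close> \<open>w \<in> U\<close> by simp
  qed
  ultimately show "\<exists>B. openin T B \<and> g \<in> B \<and> B \<subseteq> {g \<in> arrows G. src G g \<in> U}"
    using base_open[OF base_gmult[OF B(1) W(1)]] by blast
qed

lemma open_rng_vimage: assumes "openin T U" shows "openin T {g \<in> arrows G. rng G g \<in> U}"
proof -
  have "{g \<in> arrows G. rng G g \<in> U} = {g \<in> topspace T. ginv G g \<in> {g \<in> arrows G. src G g \<in> U}}"
    by (auto simp: topspace_gtop ginv_closed src_ginv)
  then show ?thesis
    using openin_continuous_map_preimage[OF continuous_ginv open_src_vimage[OF assms]] by simp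
qed

text \<open>Continuity of the product at \<open>(g, h)\<close>: any basic bisection \<open>M\<close> around \<open>h\<close> will do, because
  \<open>(V M\<inverse>) M \<subseteq> V\<close> for every set \<open>V\<close>.\<close>

lemma gmult_nhds:
  assumes "openin T W" "g \<in> arrows G" "h \<in> arrows G" "src G g = rng G h" "gmult G g h \<in> W"
  obtains N M where "openin T N" "openin T M" "g \<in> N" "h \<in> M" "set_gmult G N M \<subseteq> W"
proof -
  obtain V where V: "V \<in> base" "gmult G g h \<in> V" "V \<subseteq> W" using base_nhd assms by blast
  obtain M where M: "M \<in> base" "h \<in> M" using base_nhd assms open_arrows by blast
  define N where "N = set_gmult G V (ginv G ` M)"
  have "g = gmult G (gmult G g h) (ginv G h)" using assms by (simp add: gmult_ginv_cancel)
  then have "g \<in> N" unfolding N_def set_gmult_iff using assms V M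
    by (intro bexI[of _ "gmult G g h"] bexI[of _ "ginv G h"]) (auto simp: src_gmult rng_ginv)
  moreover have "set_gmult G N M \<subseteq> V"
  proof
    fix k assume "k \<in> set_gmult G N M"
    then obtain v x y where vxy: "v \<in> V" "x \<in> M" "y \<in> M" "src G v = rng G (ginv G x)"
      "src G (gmult G v (ginv G x)) = rng G y" "k = gmult G (gmult G v (ginv G x)) y"
      by (auto simp: set_gmult_iff N_def)
    have arr: "v \<in> arrows G" "x \<in> arrows G" "y \<in> arrows G"
      using vxy V M base_arrows by blast+
    have "rng G x = rng G y" using vxy arr by (simp add: src_gmult ginv_closed src_ginv)
    then have "x = y" using bisection_rngD base_bisection M vxy by blast
    then have "k = v" using vxy arr gmult_ginv_cancel[of v "ginv G x"]
      by (simp add: ginv_closed ginv_ginv)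
    then show "k \<in> V" using vxy by simp
  qed
  ultimately show thesis using that[of N M] V M base_open base_gmult base_ginv N_def by blast
qed

lemma continuous_gmult:
  "continuous_map
     (subtopology (prod_topology T T) {(g, h). g \<in> arrows G \<and> h \<in> arrows G \<and> src G g = rng G h})
     T (\<lambda>(g, h). gmult G g h)"
    (is "continuous_map (subtopology _ ?P) _ ?f")
proof -
  have tp: "topspace (subtopology (prod_topology T T) ?P) = ?P"
    by (auto simp: topspace_gtop)
  have "openin (subtopology (prod_topology T T) ?P) {x \<in> ?P. ?f x \<in> W}" if W: "openin T W" for W
  proof (subst openin_subopen, rule ballI)
    fix x assume x: "x \<in> {x \<in> ?P. ?f x \<in> W}"
    obtain g h where gh: "x = (g, h)" by force
    then have "g \<in> arrows G" "h \<in> arrows G" "src G g = rng G h" "gmult G g h \<in> W"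
      using x by auto
    then obtain N M where NM: "openin T N" "openin T M" "g \<in> N" "h \<in> M" "set_gmult G N M \<subseteq> W"
      using gmult_nhds[OF W] by metis
    have "openin (prod_topology T T) (N \<times> M)" using NM by (simp add: openin_prod_Times_iff)
    then have "openin (subtopology (prod_topology T T) ?P) (?P \<inter> N \<times> M)"
      by (rule openin_subtopology_Int2)
    moreover have "?P \<inter> N \<times> M \<subseteq> {x \<in> ?P. ?f x \<in> W}"
    proof
      fix z assume z: "z \<in> ?P \<inter> N \<times> M"
      obtain k l where kl: "z = (k, l)" by force
      have "gmult G k l \<in> set_gmult G N M" unfolding set_gmult_def using z kl by blast
      then show "z \<in> {x \<in> ?P. ?f x \<in> W}" using z kl NM(5) by auto
    qed
    moreover have "x \<in> ?P \<inter> N \<times> M" using x gh NM by simp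
    ultimately show "\<exists>U. openin (subtopology (prod_topology T T) ?P) U \<and> x \<in> U \<and>
        U \<subseteq> {x \<in> ?P. ?f x \<in> W}" by blast
  qed
  moreover have "?f ` ?P \<subseteq> topspace T" by (auto simp: topspace_gtop gmult_closed)
  ultimately show ?thesis unfolding continuous_map tp by blast
qed

lemma src_homeomorphic:
  assumes "openin T U" "bisection G U"
  shows "homeomorphic_map (subtopology T U) (subtopology T (src G ` U)) (src G)"
proof (rule bijective_open_imp_homeomorphic_map)
  have U: "U \<subseteq> arrows G" using assms openin_arrows by blast
  have tp: "topspace (subtopology T V) = V" if "V \<subseteq> arrows G" for V
    using that by (auto simp: topspace_gtop)
  have sU: "src G ` U \<subseteq> arrows G" using U src_closed by auto
  have "continuous_map T T (src G)"
    unfolding continuous_map topspace_gtop using open_src_vimage src_closed by auto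
  then show "continuous_map (subtopology T U) (subtopology T (src G ` U)) (src G)"
    by (auto simp: continuous_map_in_subtopology intro: continuous_map_from_subtopology)
  show "open_map (subtopology T U) (subtopology T (src G ` U)) (src G)"
    using assms open_src_image open_src_image[OF assms(1)]
    by (auto simp: open_map_def openin_open_subtopology)
  show "src G ` topspace (subtopology T U) = topspace (subtopology T (src G ` U))"
    unfolding tp[OF U] tp[OF sU] ..
  show "inj_on (src G) (topspace (subtopology T U))"
    unfolding tp[OF U] using assms by (simp add: bisection_iff)
qed

lemma etale: "etale G"
proof -
  have "local_homeomorphism T (subtopology T (units G)) (src G)"
    unfolding local_homeomorphism_def topspace_gtop
  proof
    fix g assume g: "g \<in> arrows G"
    then obtain B where B: "B \<in> base" "g \<in> B" using base_nhd open_arrows by blast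
    have s: "src G ` B \<subseteq> units G" using src_in_units base_arrows B by blast
    have "openin T (src G ` B)" "openin T B" using open_src_image base_open B by blast+
    moreover have "homeomorphic_map (subtopology T B)
        (subtopology (subtopology T (units G)) (src G ` B)) (src G)"
      using src_homeomorphic[of B] B base_open base_bisection s
      by (simp add: subtopology_subtopology Int_absorb1)
    ultimately show "\<exists>U. g \<in> U \<and> openin T U \<and> openin (subtopology T (units G)) (src G ` U) \<and>
        homeomorphic_map (subtopology T U) (subtopology (subtopology T (units G)) (src G ` U)) (src G)"
      using B s open_units by (intro exI[of _ B]) (simp add: openin_open_subtopology)
  qed
  then show ?thesis
    unfolding etale_def src_image_arrows
    using continuous_ginv continuous_gmult open_units by blast
qed

lemma bisection_compact:
  assumes "openin T U" "bisection G U" "compactin T (src G ` U)"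
  shows "compactin T U"
proof -
  have U: "U \<subseteq> topspace (subtopology T U)"
    using openin_arrows[OF assms(1)] by (simp add: topspace_gtop)
  have "compactin (subtopology T (src G ` U)) (src G ` U)"
    using assms(3) by (simp add: compactin_subtopology)
  then have "compactin (subtopology T U) U"
    using homeomorphic_map_compactness[OF src_homeomorphic[OF assms(1,2)] U] by blast
  then show ?thesis by (simp add: compactin_subtopology)
qed

lemma bisection_Hausdorff:
  assumes "Hausdorff_space (subtopology T (units G))" "openin T U" "bisection G U"
  shows "Hausdorff_space (subtopology T U)"
proof -
  have "src G ` U \<subseteq> units G" using openin_arrows[OF assms(2)] src_in_units by blast
  then have "Hausdorff_space (subtopology T (src G ` U))"
    using Hausdorff_space_subtopology[OF assms(1), of "src G ` U"]
    by (simp add: subtopology_subtopology Int_absorb1)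
  then show ?thesis
    using homeomorphic_Hausdorff_space[OF
        homeomorphic_map_imp_homeomorphic_space[OF src_homeomorphic[OF assms(2,3)]]] by simp
qed

end


section \<open>Invertible elements of a semigroupoid\<close>

context indecomposable_semigroupoid
begin

lemma sone_is_sunit: "is_sunit Y (sone Y)"
proof -
  have "e = f" if "is_sunit Y e" "is_sunit Y f" for e f
    using that unfolding is_sunit_def by (metis option.inject)
  then show ?thesis unfolding sone_def using ex_sunit theI by metis
qed

lemma sone_elts: "sone Y \<in> elts Y"
  and sone_left: "y \<in> elts Y \<Longrightarrow> pmult Y (sone Y) y = Some y"
  and sone_right: "y \<in> elts Y \<Longrightarrow> pmult Y y (sone Y) = Some y"
  using sone_is_sunit by (auto simp: is_sunit_def)

lemma sone_central: "sone Y \<in> scentre Y"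
  using central_idempotents by blast

lemma is_sinverse_sym: "is_sinverse Y y x \<Longrightarrow> y \<in> elts Y \<Longrightarrow> is_sinverse Y x y"
  by (simp add: is_sinverse_def)

lemma is_sinverse_sinv: assumes "y \<in> sinvertibles Y" shows "is_sinverse Y y (sinv Y y)"
proof -
  obtain x where x: "is_sinverse Y y x" and y: "y \<in> elts Y"
    using assms by (auto simp: sinvertibles_def)
  have "z = x" if z: "is_sinverse Y y z" for z
    using pmult_assoc[of z y x] x y z by (simp add: is_sinverse_def sone_left sone_right)
  then show ?thesis unfolding sinv_def using x theI[of "is_sinverse Y y" x] by blast
qed

text \<open>The product \<open>x'(xy)\<close> must be defined because \<open>(x'x)y = 1y\<close> is.\<close>

lemma pmult_invertible_defined:
  assumes "is_sinverse Y x x'" "x \<in> elts Y" "y \<in> elts Y"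
  shows "\<exists>z. pmult Y x y = Some z"
proof -
  have "Option.bind (pmult Y x y) (pmult Y x') = Some y"
    using pmult_assoc[of x' x y] assms by (simp add: is_sinverse_def sone_left)
  then show ?thesis by (cases "pmult Y x y") auto
qed

end


section \<open>The regular normalizers of the diagonal\<close>

text \<open>Only the semigroup and its diagonal enter the next three definitions, so every isomorphism of
  semigroups that preserves the diagonal preserves what they define.\<close>

definition central_idems :: "'x set \<Rightarrow> ('x \<Rightarrow> 'x \<Rightarrow> 'x) \<Rightarrow> 'x set" where
  "central_idems D m = {e \<in> D. (\<forall>d\<in>D. m e d = m d e) \<and> m e e = e}"

definition normal_pair :: "'x set \<Rightarrow> ('x \<Rightarrow> 'x \<Rightarrow> 'x) \<Rightarrow> 'x set \<Rightarrow> 'x \<Rightarrow> 'x \<Rightarrow> bool" where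
  "normal_pair A m E a a' \<longleftrightarrow> a \<in> A \<and> a' \<in> A \<and> m a a' \<in> E \<and> m a' a \<in> E \<and>
     m (m a a') a = a \<and> m (m a' a) a' = a' \<and>
     (\<forall>e\<in>E. m (m a e) a' \<in> E \<and> m (m a' e) a \<in> E)"

lemma normal_pair_sym: "normal_pair A m E a a' \<Longrightarrow> normal_pair A m E a' a"
  by (auto simp: normal_pair_def)

definition regular_normalizers :: "'x set \<Rightarrow> ('x \<Rightarrow> 'x \<Rightarrow> 'x) \<Rightarrow> 'x set \<Rightarrow> 'x set" where
  "regular_normalizers A m E = {a. \<exists>a'. normal_pair A m E a a'}"

lemma option_eqI: "(\<And>y. p = Some y \<longleftrightarrow> q = Some y) \<Longrightarrow> p = q"
  by (cases p; cases q) auto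

lemma restrict_map_cong:
  assumes "\<And>k. k \<in> dom a \<Longrightarrow> k \<in> S \<longleftrightarrow> k \<in> S'"
  shows "a |` S = a |` S'"
proof
  fix k show "(a |` S) k = (a |` S') k"
    using assms[of k] by (cases "a k") (simp_all add: restrict_map_def dom_def)
qed

lemma restrict_map_id:
  assumes "\<And>k. k \<in> dom a \<Longrightarrow> k \<in> S"
  shows "a |` S = a"
  using restrict_map_cong[of a S UNIV] assms by (simp add: restrict_map_def)

locale bumpy_semigroup = ample_groupoid G + indecomposable_semigroupoid Y + pfun_semigroup G c Y A m
  for G :: "'a top_groupoid" and c :: "'a \<Rightarrow> 'k" and Y :: "'y semigroupoid"
    and A :: "('a \<rightharpoonup> 'y) set" and m :: "('a \<rightharpoonup> 'y) \<Rightarrow> ('a \<rightharpoonup> 'y) \<Rightarrow> ('a \<rightharpoonup> 'y)" +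
  assumes Hausdorff_units: "Hausdorff_space (subtopology (gtop G) (units G))"
    and exhaustive_D: "exhaustive G Y (D_of G A)"
    and compact_bumpy_S: "compact_bumpy G c Y (S_of G A)"
    and CRZ_subset_S: "CRZ_of G Y A m \<subseteq> S_of G A"
begin

abbreviation "D \<equiv> D_of G A"
abbreviation "E \<equiv> central_idems D m"
abbreviation "R \<equiv> normal_pair A m E"

lemma dom_arrows: "a \<in> A \<Longrightarrow> dom a \<subseteq> arrows G"
  using dom_open openin_arrows by blast

lemma val_elts: "\<lbrakk>a \<in> A; a g = Some y\<rbrakk> \<Longrightarrow> y \<in> elts Y"
  using ran_elts by (auto simp: ran_def subset_iff)

lemma val_arrows: "\<lbrakk>a \<in> A; a g = Some y\<rbrakk> \<Longrightarrow> g \<in> arrows G"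
  using dom_arrows by blast

lemma bisection_D: "d \<in> D \<Longrightarrow> bisection G (dom d)"
  by (simp add: D_of_def bisection_subset_units)

lemma D_A: "d \<in> D \<Longrightarrow> d \<in> A"
  by (simp add: D_of_def)

lemma conv_iff:
  assumes "a \<in> A" "b \<in> A" "bisection G (dom a) \<or> bisection G (dom b)"
  shows "m a b k = Some y \<longleftrightarrow> (\<exists>g h u v. a g = Some u \<and> b h = Some v \<and> src G g = rng G h \<and>
        k = gmult G g h \<and> pmult Y u v = Some y)"
  using m_convolution[OF assms] by (simp add: is_convolution_def)

lemma D_mult_left:
  assumes "d \<in> D" "a \<in> A"
  shows "m d a k = Option.bind (a k) (\<lambda>v. Option.bind (d (rng G k)) (\<lambda>u. pmult Y u v))"
proof (rule option_eqI)
  fix y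
  have u: "g \<in> units G" if "d g = Some u" for g u using that assms by (auto simp: D_of_def)
  have "m d a k = Some y \<longleftrightarrow> (\<exists>g h u v. d g = Some u \<and> a h = Some v \<and> src G g = rng G h \<and>
      k = gmult G g h \<and> pmult Y u v = Some y)"
    using conv_iff bisection_D D_A assms by blast
  also have "\<dots> \<longleftrightarrow> (\<exists>u v. d (rng G k) = Some u \<and> a k = Some v \<and> pmult Y u v = Some y)"
  proof
    assume "\<exists>g h u v. d g = Some u \<and> a h = Some v \<and> src G g = rng G h \<and>
      k = gmult G g h \<and> pmult Y u v = Some y"
    then obtain g h x v where *: "d g = Some x" "a h = Some v" "src G g = rng G h"
      "k = gmult G g h" "pmult Y x v = Some y" by blast
    have "g \<in> units G" "h \<in> arrows G" using u[OF *(1)] val_arrows[OF assms(2) *(2)] .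
    then have "k = h" "g = rng G h"
      using gmult_unit_left[of g h] * by (simp_all add: units_iff)
    then show "\<exists>u v. d (rng G k) = Some u \<and> a k = Some v \<and> pmult Y u v = Some y" using * by blast
  next
    assume "\<exists>u v. d (rng G k) = Some u \<and> a k = Some v \<and> pmult Y u v = Some y"
    then obtain x v where *: "d (rng G k) = Some x" "a k = Some v" "pmult Y x v = Some y" by blast
    have k: "k \<in> arrows G" using val_arrows[OF assms(2) *(2)] .
    show "\<exists>g h u v. d g = Some u \<and> a h = Some v \<and> src G g = rng G h \<and>
      k = gmult G g h \<and> pmult Y u v = Some y"
      by (rule exI[of _ "rng G k"], rule exI[of _ k]) (simp add: * k src_rng gmult_rng)
  qed
  finally show "m d a k = Some y \<longleftrightarrow>
      Option.bind (a k) (\<lambda>v. Option.bind (d (rng G k)) (\<lambda>u. pmult Y u v)) = Some y"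
    by (auto simp: bind_eq_Some_conv)
qed

lemma D_mult_right:
  assumes "d \<in> D" "a \<in> A"
  shows "m a d k = Option.bind (a k) (\<lambda>u. Option.bind (d (src G k)) (\<lambda>v. pmult Y u v))"
proof (rule option_eqI)
  fix y
  have u: "g \<in> units G" if "d g = Some u" for g u using that assms by (auto simp: D_of_def)
  have "m a d k = Some y \<longleftrightarrow> (\<exists>g h u v. a g = Some u \<and> d h = Some v \<and> src G g = rng G h \<and>
      k = gmult G g h \<and> pmult Y u v = Some y)"
    using conv_iff bisection_D D_A assms by blast
  also have "\<dots> \<longleftrightarrow> (\<exists>u v. a k = Some u \<and> d (src G k) = Some v \<and> pmult Y u v = Some y)"
  proof
    assume "\<exists>g h u v. a g = Some u \<and> d h = Some v \<and> src G g = rng G h \<and>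
      k = gmult G g h \<and> pmult Y u v = Some y"
    then obtain g h x v where *: "a g = Some x" "d h = Some v" "src G g = rng G h"
      "k = gmult G g h" "pmult Y x v = Some y" by blast
    have "h \<in> units G" "g \<in> arrows G" using u[OF *(2)] val_arrows[OF assms(2) *(1)] .
    then have "k = g" "h = src G g"
      using gmult_unit_right[of h g] * by (simp_all add: units_iff)
    then show "\<exists>u v. a k = Some u \<and> d (src G k) = Some v \<and> pmult Y u v = Some y" using * by blast
  next
    assume "\<exists>u v. a k = Some u \<and> d (src G k) = Some v \<and> pmult Y u v = Some y"
    then obtain x v where *: "a k = Some x" "d (src G k) = Some v" "pmult Y x v = Some y" by blast
    have k: "k \<in> arrows G" using val_arrows[OF assms(2) *(1)] .
    show "\<exists>g h u v. a g = Some u \<and> d h = Some v \<and> src G g = rng G h \<and>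
      k = gmult G g h \<and> pmult Y u v = Some y"
      by (rule exI[of _ k], rule exI[of _ "src G k"]) (simp add: * k rng_src gmult_src)
  qed
  finally show "m a d k = Some y \<longleftrightarrow>
      Option.bind (a k) (\<lambda>u. Option.bind (d (src G k)) (\<lambda>v. pmult Y u v)) = Some y"
    by (auto simp: bind_eq_Some_conv)
qed

text \<open>Exhaustiveness of \<open>D\<close> lets any \<open>y \<in> Y\<close> be tested against the value of \<open>e\<close> at a unit, so
  commuting with \<open>D\<close> means having central values. The values are also idempotent, and \<open>1\<close> is the only
  central idempotent.\<close>

lemma E_iff: "e \<in> E \<longleftrightarrow> e \<in> A \<and> dom e \<subseteq> units G \<and> ran e \<subseteq> {sone Y}"
proof
  assume e: "e \<in> E"
  then have D: "e \<in> D" and ee: "m e e = e" and comm: "\<And>d. d \<in> D \<Longrightarrow> m e d = m d e"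
    unfolding central_idems_def by blast+
  have "y = sone Y" if y: "e u = Some y" for u y
  proof -
    have u: "u \<in> units G" "src G u = u" "rng G u = u"
      using D y by (auto simp: D_of_def units_iff)
    have "pmult Y x y = pmult Y y x" if x: "x \<in> elts Y" for x
    proof -
      obtain d where d: "d \<in> D" "d u = Some x"
        using exhaustive_D x u by (auto simp: exhaustive_def)
      have "m e d u = pmult Y y x" "m d e u = pmult Y x y"
        using D_mult_left[OF D D_A[OF d(1)], of u] D_mult_right[OF D D_A[OF d(1)], of u] u d y
        by simp_all
      then show ?thesis using comm d by simp
    qed
    then have "y \<in> scentre Y" using val_elts[OF D_A[OF D]] y by (simp add: scentre_def)
    moreover have "pmult Y y y = Some y"
      using D_mult_left[OF D D_A[OF D], of u] ee u y by simp
    ultimately show ?thesis using central_idempotents by blast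
  qed
  then have "ran e \<subseteq> {sone Y}" unfolding ran_def by blast
  then show "e \<in> A \<and> dom e \<subseteq> units G \<and> ran e \<subseteq> {sone Y}"
    using D unfolding D_of_def by blast
next
  assume "e \<in> A \<and> dom e \<subseteq> units G \<and> ran e \<subseteq> {sone Y}"
  then have D: "e \<in> D" and e: "\<And>u y. e u = Some y \<Longrightarrow> y = sone Y"
    unfolding D_of_def ran_def by blast+
  have "m e d = m d e" if d: "d \<in> D" for d
  proof
    fix k
    note eq = D_mult_left[OF D D_A[OF d], of k] D_mult_right[OF D D_A[OF d], of k]
    show "m e d k = m d e k"
    proof (cases "d k")
      case None
      then show ?thesis using eq by simp
    next
      case (Some v)
      then have k: "src G k = k" "rng G k = k" using d by (auto simp: D_of_def units_iff)
      have v: "v \<in> elts Y" using val_elts D_A d Some by blast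
      show ?thesis
      proof (cases "e k")
        case None
        then show ?thesis using eq Some k by simp
      next
        case (Some w)
        then have "w = sone Y" using e by blast
        then show ?thesis using eq \<open>d k = Some v\<close> Some k v by (simp add: sone_left sone_right)
      qed
    qed
  qed
  moreover have "m e e = e"
  proof
    fix k
    show "m e e k = e k"
    proof (cases "e k")
      case None
      then show ?thesis using D_mult_left[OF D D_A[OF D], of k] by simp
    next
      case (Some v)
      have k: "rng G k = k" using Some D by (auto simp: D_of_def units_iff)
      have v: "v = sone Y" using e[OF Some] .
      show ?thesis using D_mult_left[OF D D_A[OF D], of k] Some k v by (simp add: sone_left sone_elts)
    qed
  qed
  ultimately show "e \<in> E" using D unfolding central_idems_def by blast
qed

lemma E_val: "\<lbrakk>e \<in> E; e u = Some y\<rbrakk> \<Longrightarrow> y = sone Y"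
  unfolding E_iff ran_def by blast

lemma E_A: "e \<in> E \<Longrightarrow> e \<in> A"
  by (simp add: E_iff)

lemma E_D: "e \<in> E \<Longrightarrow> e \<in> D"
  unfolding central_idems_def by blast

lemma E_commute: "\<lbrakk>e \<in> E; f \<in> E\<rbrakk> \<Longrightarrow> m e f = m f e"
  unfolding central_idems_def by blast

lemma E_mult_left: assumes "e \<in> E" "a \<in> A" shows "m e a = a |` {k. rng G k \<in> dom e}"
proof
  fix k
  note eq = D_mult_left[OF E_D[OF assms(1)] assms(2), of k]
  show "m e a k = (a |` {k. rng G k \<in> dom e}) k"
  proof (cases "a k")
    case None
    then show ?thesis using eq by (simp add: restrict_map_def)
  next
    case (Some v)
    have v: "v \<in> elts Y" using val_elts[OF assms(2) Some] .
    show ?thesis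
    proof (cases "e (rng G k)")
      case None
      then show ?thesis using eq Some by (simp add: restrict_map_def domIff)
    next
      case (Some w)
      then have "w = sone Y" using E_val[OF assms(1)] by blast
      then show ?thesis using eq \<open>a k = Some v\<close> Some v
        by (simp add: restrict_map_def domIff sone_left sone_right)
    qed
  qed
qed

lemma E_mult_right: assumes "e \<in> E" "a \<in> A" shows "m a e = a |` {k. src G k \<in> dom e}"
proof
  fix k
  note eq = D_mult_right[OF E_D[OF assms(1)] assms(2), of k]
  show "m a e k = (a |` {k. src G k \<in> dom e}) k"
  proof (cases "a k")
    case None
    then show ?thesis using eq by (simp add: restrict_map_def)
  next
    case (Some v)
    have v: "v \<in> elts Y" using val_elts[OF assms(2) Some] .
    show ?thesis
    proof (cases "e (src G k)")
      case None
      then show ?thesis using eq Some by (simp add: restrict_map_def domIff)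
    next
      case (Some w)
      then have "w = sone Y" using E_val[OF assms(1)] by blast
      then show ?thesis using eq \<open>a k = Some v\<close> Some v
        by (simp add: restrict_map_def domIff sone_left sone_right)
    qed
  qed
qed

lemmas bumpy = compact_bumpy_S[unfolded compact_bumpy_def]

lemma one_proper: "a \<in> S_of G A \<Longrightarrow> compactin T (preim {sone Y} a)"
  using bumpy[THEN conjunct2, THEN conjunct1] by blast

lemma empty_A: "Map.empty \<in> A"
  using bumpy[THEN conjunct2, THEN conjunct2, THEN conjunct1] by (simp add: S_of_def)

lemma Urysohn:
  assumes "openin T U" "g \<in> U"
  obtains a where "a \<in> A" "dom a \<subseteq> U" "g \<in> dom a"
proof -
  obtain a where a: "a \<in> S_of G A" "dom a \<subseteq> U" "g \<in> T interior_of preim (sinvertibles Y) a"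
    using bumpy[THEN conjunct2, THEN conjunct2, THEN conjunct2, THEN conjunct1] assms by blast
  have "g \<in> preim (sinvertibles Y) a" using subsetD[OF interior_of_subset a(3)] .
  then have "g \<in> dom a" by (simp add: preim_def)
  moreover have "a \<in> A" using a(1) by (simp add: S_of_def)
  ultimately show thesis using that a(2) by blast
qed

lemma compact_Urysohn:
  assumes "compactin T K" "bisection G K" "c constant_on K"
    and "openin T U" "bisection G U" "c constant_on U" "K \<subseteq> U"
  obtains a where "a \<in> S_of G A" "dom a \<subseteq> U" "K \<subseteq> preim (sinvertibles Y) a"
  using bumpy[THEN conjunct2, THEN conjunct2, THEN conjunct2, THEN conjunct2, THEN conjunct2,
      THEN conjunct1] assms by blast

lemma compact_involutive:
  assumes "a \<in> S_of G A" "compactin T K" "K \<subseteq> preim (sinvertibles Y) a"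
  obtains b where "b \<in> S_of G A" "\<And>g. g \<in> K \<Longrightarrow> b (ginv G g) = Some (sinv Y (the (a g)))"
  using bumpy[THEN conjunct2, THEN conjunct2, THEN conjunct2, THEN conjunct2, THEN conjunct2,
      THEN conjunct2] assms by blast

lemma E_compact: assumes "e \<in> E" shows "compactin T (dom e)"
proof -
  have "e \<in> S_of G A" using assms by (simp add: S_of_def E_A bisection_D E_D)
  moreover have "preim {sone Y} e = dom e" using E_val[OF assms] by (force simp: preim_def)
  ultimately show ?thesis using one_proper by metis
qed

text \<open>Elements of \<open>A\<close> have homogeneous open domains, so the Urysohn property makes the grading
  locally constant.\<close>

lemma homogeneous_nhd:
  assumes "openin T U" "g \<in> U"
  obtains B where "B \<in> base" "g \<in> B" "B \<subseteq> U" "c constant_on B"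
proof -
  obtain a where a: "a \<in> A" "dom a \<subseteq> U" "g \<in> dom a" using Urysohn[OF assms] .
  obtain B where "B \<in> base" "g \<in> B" "B \<subseteq> dom a" using base_nhd[OF dom_open[OF a(1)] a(3)] .
  then show thesis using that a constant_on_subset[OF dom_homogeneous[OF a(1)]] by blast
qed

subsection \<open>Mutually inverse sections\<close>

definition pointwise_inverse :: "('a \<rightharpoonup> 'y) \<Rightarrow> ('a \<rightharpoonup> 'y) \<Rightarrow> bool" where
  "pointwise_inverse a a' \<longleftrightarrow> a \<in> A \<and> a' \<in> A \<and> bisection G (dom a) \<and> bisection G (dom a') \<and>
     dom a' = ginv G ` dom a \<and> (\<forall>g\<in>dom a. is_sinverse Y (the (a g)) (the (a' (ginv G g))))"

lemma pointwise_inverse_val: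
  "\<lbrakk>pointwise_inverse a a'; g \<in> dom a\<rbrakk> \<Longrightarrow> is_sinverse Y (the (a g)) (the (a' (ginv G g)))"
  by (simp add: pointwise_inverse_def)

lemma pointwise_inverse_sym:
  assumes "pointwise_inverse a a'" shows "pointwise_inverse a' a"
proof -
  have A: "a \<in> A" and a': "dom a' = ginv G ` dom a" using assms by (auto simp: pointwise_inverse_def)
  have "ginv G (ginv G g) = g" if "g \<in> dom a" for g using that dom_arrows[OF A] ginv_ginv by blast
  then have *: "dom a = ginv G ` dom a'" unfolding a' by (force simp: image_image)
  have "is_sinverse Y (the (a' g)) (the (a (ginv G g)))" if g: "g \<in> dom a'" for g
  proof -
    have "g \<in> ginv G ` dom a" using g a' by simp
    then obtain k where k: "k \<in> dom a" "g = ginv G k" by blast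
    then have "ginv G g = k" using dom_arrows[OF A] ginv_ginv by blast
    moreover have "the (a k) \<in> elts Y" using k val_elts[OF A] by auto
    ultimately show ?thesis using assms k is_sinverse_sym by (auto simp: pointwise_inverse_def)
  qed
  then show ?thesis using assms * by (auto simp: pointwise_inverse_def)
qed

text \<open>Since \<open>dom a\<close> is a bisection, an arrow \<open>g\<close> of \<open>dom x\<close> is composable with only one arrow of
  \<open>dom a'\<close>, namely \<open>g\<inverse>\<close>, and there the values multiply to \<open>1\<close>.\<close>

lemma pointwise_inverse_mult:
  assumes "pointwise_inverse a a'" "x \<in> A" "x \<subseteq>\<^sub>m a"
  shows "m x a' \<in> E" "dom (m x a') = rng G ` dom x"
proof -
  have a: "a \<in> A" "a' \<in> A" "bisection G (dom a)" "bisection G (dom a')" "dom a' = ginv G ` dom a"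
    and inv: "\<And>g. g \<in> dom a \<Longrightarrow> is_sinverse Y (the (a g)) (the (a' (ginv G g)))"
    using assms by (auto simp: pointwise_inverse_def)
  have *: "k = rng G g \<and> y = sone Y" if "x g = Some u" "a' h = Some v" "src G g = rng G h"
    "k = gmult G g h" "pmult Y u v = Some y" for g h k u v y
  proof -
    have g: "a g = Some u" using assms(3) that by (auto simp: map_le_def dom_def)
    have "h \<in> ginv G ` dom a" using that(2) a(5) by blast
    then obtain l where l: "l \<in> dom a" "h = ginv G l" by blast
    then have "src G g = src G l" using that(3) dom_arrows[OF a(1)] by (auto simp: rng_ginv)
    then have lg: "l = g" using bisection_srcD[OF a(3) _ l(1)] g by blast
    then have "pmult Y u v = Some (sone Y)"
      using inv[OF l(1)] g that(2) l by (simp add: is_sinverse_def)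
    then show ?thesis using that(4,5) l lg by (simp add: gmult_ginv)
  qed
  have iff: "m x a' k = Some y \<longleftrightarrow> (\<exists>g h u v. x g = Some u \<and> a' h = Some v \<and>
      src G g = rng G h \<and> k = gmult G g h \<and> pmult Y u v = Some y)" for k y
    using conv_iff assms(2) a by blast
  have val: "\<exists>g u. x g = Some u \<and> k = rng G g \<and> y = sone Y" if "m x a' k = Some y" for k y
    using that * unfolding iff by blast
  show dom: "dom (m x a') = rng G ` dom x"
  proof (intro equalityI subsetI)
    fix k assume "k \<in> dom (m x a')"
    then show "k \<in> rng G ` dom x" using val by blast
  next
    fix k assume "k \<in> rng G ` dom x"
    then obtain g u where g: "x g = Some u" "k = rng G g" by blast
    then have ag: "a g = Some u" using assms(3) by (auto simp: map_le_def dom_def)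
    then obtain v where "a' (ginv G g) = Some v" using a(5) by blast
    moreover have "pmult Y u v = Some (sone Y)"
      using inv[of g] ag calculation by (auto simp: is_sinverse_def)
    moreover have "src G g = rng G (ginv G g)"
      using val_arrows[OF a(1) ag] by (simp add: rng_ginv)
    ultimately have "m x a' k = Some (sone Y)"
      unfolding iff using g gmult_ginv[of g] by (metis)
    then show "k \<in> dom (m x a')" by blast
  qed
  have "rng G ` dom x \<subseteq> units G" using dom_arrows[OF assms(2)] rng_in_units by blast
  moreover have "ran (m x a') \<subseteq> {sone Y}" using val unfolding ran_def by blast
  ultimately show "m x a' \<in> E" unfolding E_iff dom using m_closed[OF assms(2) a(2)] by blast
qed

lemma pointwise_inverse_imp_R:
  assumes "pointwise_inverse a a'" shows "R a a'"
proof -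
  have half: "a \<in> A \<and> m a a' \<in> E \<and> m (m a a') a = a \<and> (\<forall>e\<in>E. m (m a e) a' \<in> E)"
    if p: "pointwise_inverse a a'" for a a'
  proof -
    have A: "a \<in> A" using p by (simp add: pointwise_inverse_def)
    have E: "m a a' \<in> E" and d: "dom (m a a') = rng G ` dom a"
      using pointwise_inverse_mult[OF p A map_le_refl] by blast+
    have "m (m a a') a = a"
      unfolding E_mult_left[OF E A] d by (rule restrict_map_id) blast
    moreover have "m (m a e) a' \<in> E" if e: "e \<in> E" for e
    proof (rule pointwise_inverse_mult(1)[OF p m_closed[OF A E_A[OF e]]])
      show "m a e \<subseteq>\<^sub>m a" unfolding E_mult_right[OF e A] by (simp add: map_le_def)
    qed
    ultimately show ?thesis using A E by blast
  qed
  show ?thesis unfolding normal_pair_def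
    using half[OF assms] half[OF pointwise_inverse_sym[OF assms]] by blast
qed

text \<open>The Compact-Urysohn function of \<open>B\<close> in \<open>B\<close> itself is everywhere invertible; an inverse
  from Compact-Involutivity can have too large a domain, which is then cut down by an idempotent.\<close>

lemma ex_pointwise_inverse:
  assumes B: "openin T B" "compactin T B" "bisection G B" "c constant_on B"
  obtains a a' where "pointwise_inverse a a'" "dom a = B"
proof -
  obtain a where a: "a \<in> S_of G A" "dom a \<subseteq> B" "B \<subseteq> preim (sinvertibles Y) a"
    using compact_Urysohn[OF B(2,3,4) B(1,3,4) subset_refl] .
  have dom: "dom a = B" using a by (auto simp: preim_def)
  obtain b where b: "b \<in> S_of G A" "\<And>g. g \<in> B \<Longrightarrow> b (ginv G g) = Some (sinv Y (the (a g)))"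
    using compact_involutive[OF a(1) B(2) a(3)] by blast
  have A: "a \<in> A" "b \<in> A" "bisection G (dom b)" using a b by (auto simp: S_of_def)
  have inv: "is_sinverse Y (the (a g)) (sinv Y (the (a g)))" if "g \<in> B" for g
    using that a is_sinverse_sinv by (auto simp: preim_def)
  have bi: "h = ginv G g" if "g \<in> B" "h \<in> dom b" "src G g = rng G h" for g h
  proof (rule bisection_rngD[OF A(3)])
    show "ginv G g \<in> dom b" using b(2)[OF that(1)] by blast
    show "rng G h = rng G (ginv G g)"
      using that dom_arrows[OF A(1)] dom by (auto simp: rng_ginv)
  qed fact
  define e where "e = m a b"
  have iff: "e k = Some y \<longleftrightarrow> (\<exists>g h u v. a g = Some u \<and> b h = Some v \<and>
      src G g = rng G h \<and> k = gmult G g h \<and> pmult Y u v = Some y)" for k y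
    unfolding e_def using conv_iff A by blast
  have e1: "k \<in> rng G ` B \<and> y = sone Y" if ek: "e k = Some y" for k y
  proof -
    obtain g h u v where gh: "a g = Some u" "b h = Some v" "src G g = rng G h"
      "k = gmult G g h" "pmult Y u v = Some y" using ek unfolding iff by blast
    have g: "g \<in> B" using gh dom by blast
    then have "h = ginv G g" using bi gh by blast
    then show ?thesis using gh g inv[OF g] b(2)[OF g] by (auto simp: gmult_ginv is_sinverse_def)
  qed
  have e2: "rng G g \<in> dom e" if g: "g \<in> B" for g
  proof -
    obtain u where u: "a g = Some u" using g dom by blast
    then have "pmult Y u (sinv Y u) = Some (sone Y)" "b (ginv G g) = Some (sinv Y u)"
      using inv[OF g] b(2)[OF g] by (auto simp: is_sinverse_def)
    moreover have "src G g = rng G (ginv G g)"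
      using val_arrows[OF A(1) u] by (simp add: rng_ginv)
    ultimately have "e (rng G g) = Some (sone Y)"
      unfolding iff using u gmult_ginv[of g] by metis
    then show ?thesis by blast
  qed
  have dome: "dom e = rng G ` B" using e1 e2 by blast
  have "rng G ` B \<subseteq> units G" using dom_arrows[OF A(1)] dom rng_in_units by blast
  moreover have "ran e \<subseteq> {sone Y}" using e1 unfolding ran_def by blast
  ultimately have e: "e \<in> E" unfolding E_iff dome using m_closed A e_def by blast
  define a' where "a' = m b e"
  have a': "a' = b |` {k. src G k \<in> rng G ` B}"
    unfolding a'_def E_mult_right[OF e A(2)] dome ..
  have doma': "dom a' = ginv G ` dom a"
  proof (intro equalityI subsetI)
    fix h assume "h \<in> dom a'"
    then have "h \<in> dom b" "src G h \<in> rng G ` B" unfolding a' by simp_all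
    then obtain g where g: "g \<in> B" "h \<in> dom b" "src G h = rng G g" by blast
    have "h = ginv G g"
    proof (rule bisection_srcD[OF A(3)])
      show "ginv G g \<in> dom b" using b(2)[OF g(1)] by blast
      show "src G h = src G (ginv G g)"
        using g dom_arrows[OF A(1)] dom by (auto simp: src_ginv)
    qed fact
    then show "h \<in> ginv G ` dom a" using g dom by blast
  next
    fix h assume "h \<in> ginv G ` dom a"
    then obtain g where g: "g \<in> B" "h = ginv G g" using dom by blast
    then have "src G h = rng G g" using dom_arrows[OF A(1)] dom by (auto simp: src_ginv)
    then show "h \<in> dom a'" using g b(2)[OF g(1)] by (auto simp: a' restrict_map_def)
  qed
  have "the (a' (ginv G g)) = sinv Y (the (a g))" if g: "g \<in> B" for g
  proof -
    have "ginv G g \<in> dom a'" using g doma' dom by blast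
    then show ?thesis using b(2)[OF g] by (auto simp: a' restrict_map_def split: if_splits)
  qed
  moreover have "dom a' \<subseteq> dom b" by (auto simp: a' restrict_map_def split: if_splits)
  then have "bisection G (dom a')"
    using A(3) inj_on_subset unfolding bisection_iff by blast
  moreover have "a' \<in> A" unfolding a'_def using m_closed A e E_A by blast
  ultimately have "pointwise_inverse a a'"
    using A B dom doma' inv by (simp add: pointwise_inverse_def)
  then show thesis using that dom by blast
qed

lemma pointwise_inverse_nhd:
  assumes "openin T U" "g \<in> U"
  obtains a a' where "pointwise_inverse a a'" "g \<in> dom a" "dom a \<subseteq> U"
proof -
  obtain B where B: "B \<in> base" "g \<in> B" "B \<subseteq> U" "c constant_on B"
    using homogeneous_nhd assms by blast
  then obtain a a' where "pointwise_inverse a a'" "dom a = B"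
    using ex_pointwise_inverse base_open base_compact base_bisection by metis
  then show thesis using that B by blast
qed

lemma units_separation:
  assumes "u \<in> units G" "v \<in> units G" "u \<noteq> v"
  obtains U V where "openin T U" "openin T V" "u \<in> U" "v \<in> V" "U \<inter> V = {}" "U \<subseteq> units G"
proof -
  have tp: "topspace (subtopology T (units G)) = units G"
    using openin_arrows[OF open_units] by (auto simp: topspace_gtop)
  then obtain U V where "openin (subtopology T (units G)) U" "openin (subtopology T (units G)) V"
    "u \<in> U" "v \<in> V" "disjnt U V"
    using Hausdorff_units assms unfolding Hausdorff_space_def by metis
  then show thesis using that open_units by (auto simp: openin_open_subtopology disjnt_def)
qed

lemma E_separates_units:
  assumes "u \<in> units G" "v \<in> units G" "u \<noteq> v"
  obtains e where "e \<in> E" "u \<in> dom e" "v \<notin> dom e"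
proof -
  obtain U V where U: "openin T U" "openin T V" "u \<in> U" "v \<in> V" "U \<inter> V = {}" "U \<subseteq> units G"
    using units_separation assms by metis
  obtain a a' where p: "pointwise_inverse a a'" and a: "u \<in> dom a" "dom a \<subseteq> U"
    using pointwise_inverse_nhd[OF U(1,3)] by blast
  have A: "a \<in> A" using p by (simp add: pointwise_inverse_def)
  have d: "dom (m a a') = rng G ` dom a"
    using pointwise_inverse_mult(2)[OF p A map_le_refl] .
  have "rng G k = k" if "k \<in> dom a" for k
  proof -
    have "k \<in> units G" using that a(2) U(6) by blast
    then show ?thesis by (simp add: units_iff)
  qed
  then have "dom (m a a') = dom a" unfolding d by force
  then show thesis
    using that[of "m a a'"] pointwise_inverse_mult(1)[OF p A map_le_refl] a U by blast
qed

subsection \<open>Regular normalizers are the invertible compact open bisections\<close>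

text \<open>For \<open>e \<in> E\<close> there is \<open>f = a'ea \<in> E\<close> with \<open>ea = af\<close>: cutting \<open>a\<close> down by a condition on ranges
  is the same as cutting it down by a condition on sources. Since \<open>E\<close> separates units, arrows of
  \<open>dom a\<close> with the same source must then have the same range, and dually.\<close>

lemma R_isosection:
  assumes r: "R a a'" and g: "g \<in> dom a" and h: "h \<in> dom a"
  shows "src G g = src G h \<longleftrightarrow> rng G g = rng G h"
proof
  note A = r[unfolded normal_pair_def]
  have units: "src G g \<in> units G" "src G h \<in> units G" "rng G g \<in> units G" "rng G h \<in> units G"
    using g h A dom_arrows src_in_units rng_in_units by blast+
  assume s: "src G g = src G h"
  show "rng G g = rng G h"
  proof (rule ccontr)
    assume "rng G g \<noteq> rng G h"
    then obtain e where e: "e \<in> E" "rng G g \<in> dom e" "rng G h \<notin> dom e"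
      using E_separates_units units by metis
    define f where "f = m (m a' e) a"
    have f: "f \<in> E" using A e f_def by blast
    have "m a f = m (m (m a a') e) a" unfolding f_def using A E_A[OF e(1)] by (simp add: m_assoc m_closed)
    also have "\<dots> = m (m e (m a a')) a" using E_commute e A by metis
    also have "\<dots> = m e a" using A E_A[OF e(1)] by (metis m_assoc m_closed)
    finally have "a |` {k. src G k \<in> dom f} = a |` {k. rng G k \<in> dom e}"
      using A e f by (simp add: E_mult_left E_mult_right)
    then have *: "dom a \<inter> {k. src G k \<in> dom f} = dom a \<inter> {k. rng G k \<in> dom e}"
      by (metis dom_restrict)
    then have "src G g \<in> dom f" using e g by blast
    then show False using * s h e by auto
  qed
next
  note A = r[unfolded normal_pair_def]
  have units: "src G g \<in> units G" "src G h \<in> units G" "rng G g \<in> units G" "rng G h \<in> units G"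
    using g h A dom_arrows src_in_units rng_in_units by blast+
  assume s: "rng G g = rng G h"
  show "src G g = src G h"
  proof (rule ccontr)
    assume "src G g \<noteq> src G h"
    then obtain e where e: "e \<in> E" "src G g \<in> dom e" "src G h \<notin> dom e"
      using E_separates_units units by metis
    define f where "f = m (m a e) a'"
    have f: "f \<in> E" using A e f_def by blast
    have "m f a = m a (m e (m a' a))" unfolding f_def using A E_A[OF e(1)] by (simp add: m_assoc m_closed)
    also have "\<dots> = m a (m (m a' a) e)" using E_commute e A by metis
    also have "\<dots> = m a e" using A E_A[OF e(1)] by (metis m_assoc m_closed)
    finally have "a |` {k. rng G k \<in> dom f} = a |` {k. src G k \<in> dom e}"
      using A e f by (simp add: E_mult_left E_mult_right)
    then have *: "dom a \<inter> {k. rng G k \<in> dom f} = dom a \<inter> {k. src G k \<in> dom e}"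
      by (metis dom_restrict)
    then have "rng G g \<in> dom f" using e g by blast
    then show False using * s h e by auto
  qed
qed

text \<open>Suppose \<open>g\<close> and \<open>h\<close> in \<open>dom a\<close> have the same range. Choose \<open>t\<close> with \<open>g \<in> dom t \<subseteq> dom a\<close> and
  a pointwise inverse \<open>t'\<close>. As \<open>dom a\<close> is an isosection, \<open>x = t'a\<close> lives on the isotropy, and
  \<open>x' = a't\<close> is a generalised inverse of \<open>x\<close> with \<open>xx' = x'x = t't\<close>. So \<open>x\<close> satisfies the definition
  of \<open>CRZ_of\<close> and \<open>dom x\<close> is a bisection. It contains \<open>g\<inverse> g\<close> and \<open>g\<inverse> h\<close>, which have the same range.\<close>

lemma R_bisection: assumes r: "R a a'" shows "bisection G (dom a)"
proof -
  have A: "a \<in> A" "a' \<in> A" "m a a' \<in> E" "m a' a \<in> E" "m (m a a') a = a"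
    using r by (auto simp: normal_pair_def)
  have a_f1: "m a (m a' a) = a" using A m_assoc by metis
  have "g = h" if g: "g \<in> dom a" and h: "h \<in> dom a" and gh: "rng G g = rng G h" for g h
  proof -
    obtain t t' where p: "pointwise_inverse t t'" and gt: "g \<in> dom t" and ta: "dom t \<subseteq> dom a"
      using pointwise_inverse_nhd[OF dom_open[OF A(1)] g] by blast
    have t: "t \<in> A" "t' \<in> A" "bisection G (dom t)" "bisection G (dom t')" "dom t' = ginv G ` dom t"
      using p by (auto simp: pointwise_inverse_def)
    have rt: "m t t' \<in> E" "m t' t \<in> E" "m (m t t') t = t" "m (m t' t) t' = t'"
      using pointwise_inverse_imp_R[OF p] by (auto simp: normal_pair_def)
    have domp: "dom (m t t') = rng G ` dom t"
      using pointwise_inverse_mult(2)[OF p t(1) map_le_refl] .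
    have "rng G ` dom t' = src G ` dom t"
      unfolding t(5) image_image using dom_arrows[OF t(1)] rng_ginv by (intro image_cong) blast+
    then have domf: "dom (m t' t) = src G ` dom t"
      using pointwise_inverse_mult(2)[OF pointwise_inverse_sym[OF p] t(2) map_le_refl] by simp
    define x where "x = m t' a"
    define x' where "x' = m a' t"
    define f where "f = m t' t"
    have xA: "x \<in> A" "x' \<in> A" "f \<in> A" "f \<in> E"
      using A t rt by (auto simp: x_def x'_def f_def m_closed)
    have rng_a: "rng G k \<in> dom (m a a')" if "k \<in> dom a" for k
      using that A(5) unfolding E_mult_left[OF A(3,1)]
      by (metis (mono_tags) IntD2 dom_restrict mem_Collect_eq)
    have src_a: "src G k \<in> dom (m a' a)" if "k \<in> dom a" for k
      using that a_f1 unfolding E_mult_right[OF A(4,1)]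
      by (metis (mono_tags) IntD2 dom_restrict mem_Collect_eq)
    have e1: "m (m a a') t = t"
      unfolding E_mult_left[OF A(3) t(1)] using ta rng_a
      by (intro restrict_map_id) blast
    have e2: "m (m t t') a = m a f"
    proof -
      have "rng G k \<in> rng G ` dom t \<longleftrightarrow> src G k \<in> src G ` dom t" if "k \<in> dom a" for k
        using R_isosection[OF r that] ta by blast
      then show ?thesis
        unfolding f_def E_mult_left[OF rt(1) A(1)] E_mult_right[OF rt(2) A(1)] domp domf
        by (intro restrict_map_cong) blast
    qed
    have e3: "m (m a' a) f = f"
    proof -
      have "rng G k \<in> dom (m a' a)" if k: "k \<in> dom f" for k
      proof -
        obtain l where "l \<in> dom t" "k = src G l" using k domf f_def by auto
        then show ?thesis using ta src_a dom_arrows[OF A(1)] by (auto simp: rng_src subset_iff)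
      qed
      then show ?thesis
        unfolding E_mult_left[OF A(4) xA(3)] by (intro restrict_map_id) blast
    qed
    \<comment> \<open>The ranges of \<open>t\<close> lie in \<open>dom (aa')\<close> and its sources in \<open>dom (a'a)\<close>, so \<open>aa'\<close> and \<open>a'a\<close>
      act as identities below.\<close>
    have xx': "m x x' = f"
    proof -
      have "m x x' = m t' (m (m a a') t)" using A t by (simp add: x_def x'_def m_assoc m_closed)
      then show ?thesis by (simp add: e1 f_def)
    qed
    have x'x: "m x' x = f"
    proof -
      have "m x' x = m a' (m (m t t') a)" using A t by (simp add: x_def x'_def m_assoc m_closed)
      also have "\<dots> = m (m a' a) f" using e2 m_assoc A xA by simp
      finally show ?thesis by (simp add: e3)
    qed
    have fx: "m f x = x" unfolding x_def f_def using rt(4) A t by (metis m_assoc m_closed)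
    have x'f: "m x' f = x'"
    proof -
      have "m x' f = m a' (m (m t t') t)" using A t by (simp add: x'_def f_def m_assoc m_closed)
      then show ?thesis by (simp add: rt(3) x'_def)
    qed
    have fx': "m f x' = x'" using x'f x'x xx' m_assoc xA by metis
    have x_iso: "dom x \<subseteq> iso_arrows G"
    proof
      fix k assume "k \<in> dom x"
      then obtain y where "m t' a k = Some y" by (auto simp: x_def)
      then obtain l j where lj: "l \<in> dom t'" "j \<in> dom a" "src G l = rng G j" "k = gmult G l j"
        using conv_iff[OF t(2) A(1)] t(4) by blast
      then obtain i where i: "i \<in> dom t" "l = ginv G i" using t(5) by blast
      have arr: "i \<in> arrows G" "j \<in> arrows G" "i \<in> dom a"
        using i lj ta dom_arrows[OF A(1)] by blast+
      have "rng G i = rng G j" using lj i arr by (simp add: src_ginv)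
      moreover have "src G i = src G j" using R_isosection[OF r arr(3) lj(2)] calculation by simp
      ultimately show "k \<in> iso_arrows G"
        using ginv_gmult_cancel[of i j] arr lj i by (simp add: iso_arrows_def)
    qed
    have ex: "m e x = m x e" if e: "e \<in> E" for e
    proof -
      have "rng G k = src G k" if "k \<in> dom x" for k using x_iso that by (auto simp: iso_arrows_def)
      then show ?thesis unfolding E_mult_left[OF e xA(1)] E_mult_right[OF e xA(1)]
        by (intro restrict_map_cong) simp
    qed
    \<comment> \<open>A generalised inverse of \<open>x\<close> inherits commutation with the idempotents from \<open>x\<close>.\<close>
    have ex': "m x' e = m e x'" if e: "e \<in> E" for e
    proof -
      note eA = E_A[OF e]
      have "m x' e = m x' (m f e)" using x'f m_assoc xA eA by metis
      also have "\<dots> = m x' (m e (m x x'))" using E_commute[OF e xA(4)] xx' by simp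
      also have "\<dots> = m x' (m (m e x) x')" using m_assoc xA eA by simp
      also have "\<dots> = m x' (m (m x e) x')" using ex[OF e] by simp
      also have "\<dots> = m (m x' x) (m e x')" using m_assoc xA eA by (simp add: m_closed)
      also have "\<dots> = m (m f e) x'" using x'x m_assoc xA eA by simp
      also have "\<dots> = m (m e f) x'" using E_commute[OF e xA(4)] by simp
      also have "\<dots> = m e x'" using fx' m_assoc xA eA by simp
      finally show ?thesis .
    qed
    have x'_iso: "dom x' \<subseteq> iso_arrows G"
    proof (rule subsetI, rule ccontr)
      fix k assume k: "k \<in> dom x'" "k \<notin> iso_arrows G"
      have arr: "k \<in> arrows G" using k dom_arrows[OF xA(2)] by blast
      then have "src G k \<noteq> rng G k" using k by (simp add: iso_arrows_def)
      then obtain e where e: "e \<in> E" "src G k \<in> dom e" "rng G k \<notin> dom e"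
        using E_separates_units src_in_units[OF arr] rng_in_units[OF arr] by metis
      have "x' |` {k. src G k \<in> dom e} = x' |` {k. rng G k \<in> dom e}"
        using ex'[OF e(1)] E_mult_left[OF e(1) xA(2)] E_mult_right[OF e(1) xA(2)] by simp
      then have "dom x' \<inter> {k. src G k \<in> dom e} = dom x' \<inter> {k. rng G k \<in> dom e}"
        by (metis dom_restrict)
      then show False using e k by blast
    qed
    have "f \<in> Z_of G Y A"
      using xA(4) sone_central unfolding Z_of_def E_iff by blast
    then have "x \<in> CRZ_of G Y A m"
      unfolding CRZ_of_def C_of_def using xA x_iso x'_iso xx' x'x fx fx' by auto
    then have bx: "bisection G (dom x)" using CRZ_subset_S by (auto simp: S_of_def)
    have garr: "g \<in> arrows G" "h \<in> arrows G" using g h dom_arrows[OF A(1)] by blast+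
    have in_x: "gmult G (ginv G g) k \<in> dom x" if k: "k \<in> dom a" "rng G g = rng G k" for k
    proof -
      obtain v where v: "a k = Some v" using k by blast
      obtain u where u: "t' (ginv G g) = Some u" using gt t(5) by blast
      have "is_sinverse Y u (the (t (ginv G (ginv G g))))"
        using pointwise_inverse_val[OF pointwise_inverse_sym[OF p], of "ginv G g"] u
        by (simp add: domI)
      then obtain y where "pmult Y u v = Some y"
        using pmult_invertible_defined val_elts[OF t(2) u] val_elts[OF A(1) v] by blast
      moreover have "src G (ginv G g) = rng G k" using garr k by (simp add: src_ginv)
      ultimately have "x (gmult G (ginv G g) k) = Some y"
        unfolding x_def conv_iff[OF t(2) A(1) disjI1[OF t(4)]] using u v by blast
      then show ?thesis by blast
    qed
    have "gmult G (ginv G g) h = gmult G (ginv G g) g"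
      using bisection_rngD[OF bx in_x[OF h gh] in_x[OF g refl]]
        ginv_gmult_cancel(3)[OF garr gh] ginv_gmult_cancel(3)[OF garr(1) garr(1) refl] by simp
    then show "g = h"
      using ginv_gmult_cancel(4)[OF garr gh] ginv_gmult_cancel(4)[OF garr(1) garr(1) refl] by simp
  qed
  then have "inj_on (rng G) (dom a)" by (auto simp: inj_on_def)
  moreover then have "inj_on (src G) (dom a)"
    using R_isosection[OF r] unfolding inj_on_def by blast
  ultimately show ?thesis using dom_arrows[OF A(1)] by (simp add: bisection_iff)
qed

text \<open>Both domains are bisections by now, so \<open>aa'\<close> and \<open>a'a\<close> can be computed pointwise: their value
  \<open>1\<close> at the range of \<open>g\<close> can only come from the factorisation \<open>g g\<inverse>\<close>.\<close>

lemma R_imp_pointwise_inverse: assumes r: "R a a'" shows "pointwise_inverse a a'"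
proof -
  have half: "ginv G g \<in> dom a' \<and> pmult Y (the (a g)) (the (a' (ginv G g))) = Some (sone Y)"
    if r: "R a a'" and g: "g \<in> dom a" for a a' g
  proof -
    have A: "a \<in> A" "a' \<in> A" "m a a' \<in> E" "m (m a a') a = a"
      using r by (auto simp: normal_pair_def)
    have b: "bisection G (dom a)" by (rule R_bisection[OF r])
    have garr: "g \<in> arrows G" using g dom_arrows[OF A(1)] by blast
    have "rng G g \<in> dom (m a a')"
      using g A(4) unfolding E_mult_left[OF A(3,1)]
      by (metis (mono_tags) IntD2 dom_restrict mem_Collect_eq)
    then have "m a a' (rng G g) = Some (sone Y)" using E_val[OF A(3)] by blast
    then obtain k l u v where kl: "a k = Some u" "a' l = Some v" "src G k = rng G l"
      "rng G g = gmult G k l" "pmult Y u v = Some (sone Y)"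
      using conv_iff[OF A(1,2)] b by blast
    have arr: "k \<in> arrows G" "l \<in> arrows G"
      using val_arrows[OF A(1) kl(1)] val_arrows[OF A(2) kl(2)] by blast+
    have "rng G k = rng G g" using rng_gmult[OF arr kl(3)] kl(4) rng_rng[OF garr] by simp
    then have kg: "k = g" using bisection_rngD[OF b] kl(1) g by blast
    have "l = gmult G (ginv G g) (gmult G g l)"
      using ginv_gmult_cancel(4)[of "ginv G g" l] garr arr kl(3) kg
      by (simp add: ginv_ginv ginv_closed rng_ginv)
    also have "\<dots> = ginv G g"
      using gmult_src[of "ginv G g"] garr kl(4) kg by (simp add: ginv_closed src_ginv)
    finally show ?thesis using kl kg by auto
  qed
  note r' = normal_pair_sym[OF r]
  have A: "a \<in> A" "a' \<in> A" using r by (auto simp: normal_pair_def)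
  have "dom a' = ginv G ` dom a"
  proof (intro equalityI subsetI)
    fix k assume k: "k \<in> dom a'"
    then have "k = ginv G (ginv G k)" using dom_arrows[OF A(2)] ginv_ginv by auto
    then show "k \<in> ginv G ` dom a" using half[OF r' k] by blast
  next
    fix k assume "k \<in> ginv G ` dom a"
    then show "k \<in> dom a'" using half[OF r] by blast
  qed
  moreover have "is_sinverse Y (the (a g)) (the (a' (ginv G g)))" if g: "g \<in> dom a" for g
  proof -
    have "ginv G (ginv G g) = g" using g dom_arrows[OF A(1)] ginv_ginv by blast
    moreover have "the (a' (ginv G g)) \<in> elts Y"
      using half[OF r g] val_elts[OF A(2)] by auto
    ultimately show ?thesis
      using half[OF r g] half[OF r', of "ginv G g"] by (simp add: is_sinverse_def)
  qed
  ultimately show ?thesis using A R_bisection[OF r] R_bisection[OF r']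
    by (simp add: pointwise_inverse_def)
qed

subsection \<open>Reading off the groupoid from its regular normalizers\<close>

abbreviation "I \<equiv> regular_normalizers A m E"

lemma I_iff: "a \<in> I \<longleftrightarrow> (\<exists>a'. pointwise_inverse a a')"
  unfolding regular_normalizers_def
  using R_imp_pointwise_inverse pointwise_inverse_imp_R by blast

lemma I_A: "a \<in> I \<Longrightarrow> a \<in> A"
  unfolding I_iff pointwise_inverse_def by blast

lemma I_bisection: "a \<in> I \<Longrightarrow> bisection G (dom a)"
  unfolding I_iff pointwise_inverse_def by blast

lemma I_open: "a \<in> I \<Longrightarrow> openin T (dom a)"
  using I_A dom_open by blast

lemma pointwise_inverse_mult_left:
  assumes "pointwise_inverse a a'" shows "m a' a \<in> E" "dom (m a' a) = src G ` dom a"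
proof -
  have a: "a \<in> A" "a' \<in> A" "dom a' = ginv G ` dom a"
    using assms by (auto simp: pointwise_inverse_def)
  have "rng G ` dom a' = src G ` dom a"
    unfolding a(3) image_image using dom_arrows[OF a(1)] rng_ginv by (intro image_cong) blast+
  then show "m a' a \<in> E" "dom (m a' a) = src G ` dom a"
    using pointwise_inverse_mult[OF pointwise_inverse_sym[OF assms] a(2) map_le_refl] by simp_all
qed

text \<open>The source map is a homeomorphism from the open bisection \<open>dom a\<close> onto the compact set
  \<open>dom (a'a)\<close>.\<close>

lemma I_compact: assumes "a \<in> I" shows "compactin T (dom a)"
proof -
  obtain a' where p: "pointwise_inverse a a'" using assms I_iff by blast
  show ?thesis
    using bisection_compact[OF I_open[OF assms] I_bisection[OF assms]]
      E_compact[OF pointwise_inverse_mult_left(1)[OF p]] pointwise_inverse_mult_left(2)[OF p] by simp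
qed

lemma I_nhd:
  assumes "openin T U" "g \<in> U" obtains a where "a \<in> I" "g \<in> dom a" "dom a \<subseteq> U"
  using pointwise_inverse_nhd[OF assms] I_iff by metis

text \<open>Invertibility of the values of \<open>a\<close> ensures that no product of values is undefined.\<close>

lemma I_dom_mult:
  assumes "a \<in> I" "b \<in> I" shows "dom (m a b) = set_gmult G (dom a) (dom b)"
proof (intro equalityI subsetI)
  note conv = conv_iff[OF I_A[OF assms(1)] I_A[OF assms(2)] disjI1[OF I_bisection[OF assms(1)]]]
  fix k
  show "k \<in> set_gmult G (dom a) (dom b)" if k: "k \<in> dom (m a b)"
  proof -
    obtain y where "m a b k = Some y" using k by blast
    then show ?thesis unfolding conv set_gmult_iff by blast
  qed
  show "k \<in> dom (m a b)" if "k \<in> set_gmult G (dom a) (dom b)"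
  proof -
    obtain g h u v where gh: "a g = Some u" "b h = Some v" "src G g = rng G h" "k = gmult G g h"
      using \<open>k \<in> set_gmult G (dom a) (dom b)\<close> unfolding set_gmult_iff by blast
    obtain a' where "pointwise_inverse a a'" using assms I_iff by blast
    then have "is_sinverse Y u (the (a' (ginv G g)))"
      using pointwise_inverse_val[of a a' g] gh(1) by (simp add: domI)
    then obtain y where "pmult Y u v = Some y"
      using pmult_invertible_defined val_elts[OF I_A[OF assms(1)] gh(1)]
        val_elts[OF I_A[OF assms(2)] gh(2)] by blast
    then have "m a b k = Some y" unfolding conv using gh by blast
    then show ?thesis by blast
  qed
qed

text \<open>For \<open>ab\<close> and \<open>b'a'\<close>, each of \<open>a\<close> and \<open>b\<close> conjugates \<open>E\<close> into itself, so \<open>abb'a' \<in> E\<close>; and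
  \<open>abb'a'ab = ab\<close> because the idempotents \<open>bb'\<close> and \<open>a'a\<close> commute. The remaining conditions
  follow by exchanging the roles of the two elements.\<close>

lemma I_mult: assumes "a \<in> I" "b \<in> I" shows "m a b \<in> I"
proof -
  have half: "m (m a b) (m b' a') \<in> E \<and> m (m (m a b) (m b' a')) (m a b) = m a b \<and>
      (\<forall>e\<in>E. m (m (m a b) e) (m b' a') \<in> E)"
    if a: "R a a'" and b: "R b b'" for a a' b b'
  proof -
    note a = a[unfolded normal_pair_def] and b = b[unfolded normal_pair_def]
    have A: "a \<in> A" "a' \<in> A" "b \<in> A" "b' \<in> A" using a b by blast+
    have idem: "m a a' \<in> E" "m a' a \<in> E" "m b b' \<in> E" "m (m a a') a = a" "m (m b b') b = b"
      using a b by blast+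
    have conj: "m (m x e) x' \<in> E" if "x = a \<and> x' = a' \<or> x = b \<and> x' = b'" "e \<in> E" for x x' e
      using a b that by blast
    have "m (m a b) (m b' a') = m (m a (m b b')) a'" using A by (simp add: m_assoc m_closed)
    then have 1: "m (m a b) (m b' a') \<in> E" using conj idem(3) by metis
    have "m (m (m a b) (m b' a')) (m a b) = m a (m (m (m b b') (m a' a)) b)"
      using A by (simp add: m_assoc m_closed)
    also have "\<dots> = m a (m (m (m a' a) (m b b')) b)"
      unfolding E_commute[OF idem(3,2)] ..
    also have "\<dots> = m (m (m a a') a) (m (m b b') b)" using A by (simp add: m_assoc m_closed)
    also have "\<dots> = m a b" unfolding idem(4,5) ..
    finally have 2: "m (m (m a b) (m b' a')) (m a b) = m a b" .
    have "m (m (m a b) e) (m b' a') = m (m a (m (m b e) b')) a'" if "e \<in> E" for e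
      using A E_A[OF that] by (simp add: m_assoc m_closed)
    then have "m (m (m a b) e) (m b' a') \<in> E" if "e \<in> E" for e
      using that conj by metis
    then show ?thesis using 1 2 by blast
  qed
  obtain a' b' where r: "R a a'" "R b b'"
    using assms unfolding regular_normalizers_def by blast
  have A: "m a b \<in> A" "m b' a' \<in> A" using r by (auto simp: normal_pair_def m_closed)
  have "R (m a b) (m b' a')"
    unfolding normal_pair_def
    using A half[OF r] half[OF normal_pair_sym[OF r(2)] normal_pair_sym[OF r(1)]] by blast
  then show ?thesis unfolding regular_normalizers_def by blast
qed

text \<open>If \<open>dom a \<subseteq> dom b\<close>, then \<open>d = ab'\<close> is supported on units, because \<open>dom b\<close> is a bisection, and
  \<open>db = ab'b = a\<close>. This turns inclusion of domains into an algebraic relation.\<close>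

lemma I_dom_subset_iff:
  assumes "a \<in> I" "b \<in> I" shows "dom a \<subseteq> dom b \<longleftrightarrow> (\<exists>d\<in>D. a = m d b)"
proof
  assume sub: "dom a \<subseteq> dom b"
  obtain b' where p: "pointwise_inverse b b'" using assms I_iff by blast
  have b: "b \<in> A" "b' \<in> A" "bisection G (dom b)" "dom b' = ginv G ` dom b"
    using p by (auto simp: pointwise_inverse_def)
  have "dom (m a b') \<subseteq> units G"
  proof
    fix k assume "k \<in> dom (m a b')"
    then obtain y where "m a b' k = Some y" by blast
    then obtain g h where gh: "g \<in> dom a" "h \<in> dom b'" "src G g = rng G h" "k = gmult G g h"
      unfolding conv_iff[OF I_A[OF assms(1)] b(2) disjI1[OF I_bisection[OF assms(1)]]] by blast
    then obtain l where l: "l \<in> dom b" "h = ginv G l" using b(4) by blast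
    have arr: "g \<in> arrows G" "l \<in> arrows G"
      using gh(1) l(1) sub dom_arrows[OF b(1)] by blast+
    have "src G g = src G l" using gh(3) l(2) arr by (simp add: rng_ginv)
    then have "g = l" using bisection_srcD[OF b(3) _ l(1)] gh(1) sub by blast
    then show "k \<in> units G" using gh(4) l(2) rng_in_units[OF arr(1)] by (simp add: gmult_ginv)
  qed
  then have D: "m a b' \<in> D" using m_closed[OF I_A[OF assms(1)] b(2)] by (simp add: D_of_def)
  have "m (m a b') b = m a (m b' b)" using m_assoc[OF I_A[OF assms(1)] b(2,1)] .
  also have "\<dots> = a"
    unfolding E_mult_right[OF pointwise_inverse_mult_left(1)[OF p] I_A[OF assms(1)]] pointwise_inverse_mult_left(2)[OF p]
    by (rule restrict_map_id) (use sub in blast)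
  finally show "\<exists>d\<in>D. a = m d b" using D by metis
next
  assume "\<exists>d\<in>D. a = m d b"
  then obtain d where d: "d \<in> D" "a = m d b" by blast
  show "dom a \<subseteq> dom b"
  proof
    fix k assume "k \<in> dom a"
    then show "k \<in> dom b"
      using D_mult_left[OF d(1) I_A[OF assms(2)], of k] d(2) by (cases "b k") auto
  qed
qed

text \<open>A bisection around \<open>g\<close> contains no other arrow with the same source as \<open>g\<close>. Arrows with different
  sources are separated because the unit space is Hausdorff.\<close>

lemma I_separates:
  assumes "g \<in> arrows G" "h \<in> arrows G" "g \<noteq> h"
  obtains a where "a \<in> I" "g \<in> dom a" "h \<notin> dom a"
proof (cases "src G g = src G h")
  case True
  obtain a where a: "a \<in> I" "g \<in> dom a" using I_nhd[OF open_arrows assms(1)] by blast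
  then have "h \<notin> dom a" using bisection_srcD[OF I_bisection] True assms by blast
  then show thesis using that a by blast
next
  case False
  then obtain U V where U: "openin T U" "openin T V" "src G g \<in> U" "src G h \<in> V" "U \<inter> V = {}"
    using units_separation[OF src_in_units[OF assms(1)] src_in_units[OF assms(2)]] by metis
  have "g \<in> {g \<in> arrows G. src G g \<in> U}" using assms U by blast
  then obtain a where "a \<in> I" "g \<in> dom a" "dom a \<subseteq> {g \<in> arrows G. src G g \<in> U}"
    using I_nhd[OF open_src_vimage[OF U(1)]] by blast
  then show thesis using that U by blast
qed

text \<open>Non-composable arrows are told apart by disjoint neighbourhoods of the source of one and of the
  range of the other, which makes some product of regular normalizers empty.\<close>

lemma composable_iff:
  assumes "g \<in> arrows G" "h \<in> arrows G"
  shows "src G g = rng G h \<longleftrightarrow>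
    (\<forall>a\<in>I. \<forall>b\<in>I. g \<in> dom a \<longrightarrow> h \<in> dom b \<longrightarrow> m a b \<noteq> Map.empty)"
proof
  assume s: "src G g = rng G h"
  show "\<forall>a\<in>I. \<forall>b\<in>I. g \<in> dom a \<longrightarrow> h \<in> dom b \<longrightarrow> m a b \<noteq> Map.empty"
  proof (intro ballI impI)
    fix a b assume ab: "a \<in> I" "b \<in> I" "g \<in> dom a" "h \<in> dom b"
    then have "gmult G g h \<in> set_gmult G (dom a) (dom b)" using s by (auto simp: set_gmult_iff)
    then have "dom (m a b) \<noteq> {}" using I_dom_mult ab by blast
    then show "m a b \<noteq> Map.empty" by auto
  qed
next
  assume R: "\<forall>a\<in>I. \<forall>b\<in>I. g \<in> dom a \<longrightarrow> h \<in> dom b \<longrightarrow> m a b \<noteq> Map.empty"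
  show "src G g = rng G h"
  proof (rule ccontr)
    assume "src G g \<noteq> rng G h"
    then obtain U V where U: "openin T U" "openin T V" "src G g \<in> U" "rng G h \<in> V" "U \<inter> V = {}"
      using units_separation[OF src_in_units[OF assms(1)] rng_in_units[OF assms(2)]] by metis
    have "g \<in> {g \<in> arrows G. src G g \<in> U}" using assms U by blast
    then obtain a where a: "a \<in> I" "g \<in> dom a" "dom a \<subseteq> {g \<in> arrows G. src G g \<in> U}"
      using I_nhd[OF open_src_vimage[OF U(1)]] by blast
    have "h \<in> {h \<in> arrows G. rng G h \<in> V}" using assms U by blast
    then obtain b where b: "b \<in> I" "h \<in> dom b" "dom b \<subseteq> {h \<in> arrows G. rng G h \<in> V}"
      using I_nhd[OF open_rng_vimage[OF U(2)]] by blast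
    have "set_gmult G (dom a) (dom b) = {}"
    proof (rule ccontr)
      assume "set_gmult G (dom a) (dom b) \<noteq> {}"
      then obtain x y where "x \<in> dom a" "y \<in> dom b" "src G x = rng G y"
        unfolding set_gmult_def by blast
      then have "src G x \<in> U \<inter> V" using a(3) b(3) by auto
      then show False using U(5) by blast
    qed
    then have "m a b = Map.empty" using I_dom_mult[OF a(1) b(1)] by simp
    then show False using R a b by blast
  qed
qed

lemma empty_zero: assumes "b \<in> A" shows "m Map.empty b = Map.empty" "m b Map.empty = Map.empty"
proof -
  have bi: "bisection G (dom (Map.empty :: 'a \<rightharpoonup> 'y))" by (simp add: bisection_iff)
  have "m Map.empty b k \<noteq> Some y" for k y
    unfolding conv_iff[OF empty_A assms disjI1[OF bi]] by simp
  moreover have "m b Map.empty k \<noteq> Some y" for k y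
    unfolding conv_iff[OF assms empty_A disjI2[OF bi]] by simp
  ultimately show "m Map.empty b = Map.empty" "m b Map.empty = Map.empty"
    by (metis option.exhaust ext)+
qed

end


section \<open>Diagonal isomorphisms induce groupoid isomorphisms\<close>

locale bumpy_iso = X: bumpy_semigroup G c Y A m + X': bumpy_semigroup G' c' Y' A' m'
  for G :: "'a top_groupoid" and c :: "'a \<Rightarrow> 'k" and Y :: "'y semigroupoid" and A m
    and G' :: "'b top_groupoid" and c' :: "'b \<Rightarrow> 'l" and Y' :: "'z semigroupoid" and A' m' +
  fixes \<phi>
  assumes iso: "semigroup_iso A m A' m' \<phi>"
    and diagonal: "\<phi> ` D_of G A = D_of G' A'"
begin

lemma phi_A: "a \<in> A \<Longrightarrow> \<phi> a \<in> A'"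
  and phi_inj: "\<lbrakk>a \<in> A; b \<in> A\<rbrakk> \<Longrightarrow> \<phi> a = \<phi> b \<longleftrightarrow> a = b"
  and phi_mult: "\<lbrakk>a \<in> A; b \<in> A\<rbrakk> \<Longrightarrow> \<phi> (m a b) = m' (\<phi> a) (\<phi> b)"
  using iso by (auto simp: semigroup_iso_def bij_betw_def inj_on_def)

lemma phi_surj: "A' = \<phi> ` A"
  using iso by (auto simp: semigroup_iso_def bij_betw_def)

lemma flip: "bumpy_iso G' c' Y' A' m' G c Y A m (inv_into A \<phi>)"
proof unfold_locales
  have inj: "inj_on \<phi> A" and im: "\<phi> ` A = A'"
    using iso by (auto simp: semigroup_iso_def bij_betw_def)
  have "inv_into A \<phi> (m' a b) = m (inv_into A \<phi> a) (inv_into A \<phi> b)"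
    if ab: "a \<in> A'" "b \<in> A'" for a b
  proof -
    have *: "inv_into A \<phi> a \<in> A" "inv_into A \<phi> b \<in> A" using ab im inv_into_into by metis+
    have "\<phi> (m (inv_into A \<phi> a) (inv_into A \<phi> b)) = m' a b"
      using phi_mult[OF *] ab im f_inv_into_f by metis
    then show ?thesis using inv_into_f_f[OF inj] X.m_closed[OF *] by metis
  qed
  then show "semigroup_iso A' m' A m (inv_into A \<phi>)"
    using bij_betw_inv_into iso by (auto simp: semigroup_iso_def)
  show "inv_into A \<phi> ` D_of G' A' = D_of G A"
    using diagonal inv_into_image_cancel[OF inj] X.D_A by (metis subsetI)
qed

lemma inv_phi: "a \<in> A \<Longrightarrow> inv_into A \<phi> (\<phi> a) = a"
  using iso by (simp add: semigroup_iso_def bij_betw_def)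

lemma phi_D: "a \<in> A \<Longrightarrow> \<phi> a \<in> X'.D \<longleftrightarrow> a \<in> X.D"
  using diagonal phi_inj X.D_A by blast

lemma phi_E: assumes "a \<in> A" shows "\<phi> a \<in> X'.E \<longleftrightarrow> a \<in> X.E"
proof -
  have "\<phi> a \<in> X'.E \<longleftrightarrow> \<phi> a \<in> X'.D \<and> (\<forall>d\<in>X.D. m' (\<phi> a) (\<phi> d) = m' (\<phi> d) (\<phi> a)) \<and>
      m' (\<phi> a) (\<phi> a) = \<phi> a"
    unfolding central_idems_def diagonal[symmetric] by blast
  also have "\<dots> \<longleftrightarrow> a \<in> X.D \<and> (\<forall>d\<in>X.D. \<phi> (m a d) = \<phi> (m d a)) \<and> \<phi> (m a a) = \<phi> a"
    using phi_D[OF assms] phi_mult[OF assms] phi_mult[OF _ assms] X.D_A assms by metis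
  also have "\<dots> \<longleftrightarrow> a \<in> X.D \<and> (\<forall>d\<in>X.D. m a d = m d a) \<and> m a a = a"
    using phi_inj X.m_closed X.D_A assms by metis
  finally show ?thesis unfolding central_idems_def by blast
qed

lemma E'_eq: "X'.E = \<phi> ` X.E"
  using phi_E phi_surj X'.E_A X.E_A by blast

lemma phi_R: assumes "a \<in> A" "b \<in> A" shows "X'.R (\<phi> a) (\<phi> b) \<longleftrightarrow> X.R a b"
proof -
  have 1: "m' (\<phi> x) (\<phi> y) \<in> X'.E \<longleftrightarrow> m x y \<in> X.E"
    and 2: "m' (m' (\<phi> x) (\<phi> y)) (\<phi> x) = \<phi> x \<longleftrightarrow> m (m x y) x = x"
    and 3: "(\<forall>e\<in>X'.E. m' (m' (\<phi> x) e) (\<phi> y) \<in> X'.E) \<longleftrightarrow> (\<forall>e\<in>X.E. m (m x e) y \<in> X.E)"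
    if xy: "x \<in> A" "y \<in> A" for x y
  proof -
    show "m' (\<phi> x) (\<phi> y) \<in> X'.E \<longleftrightarrow> m x y \<in> X.E"
      using phi_mult phi_E X.m_closed xy by metis
    show "m' (m' (\<phi> x) (\<phi> y)) (\<phi> x) = \<phi> x \<longleftrightarrow> m (m x y) x = x"
      using phi_mult phi_inj X.m_closed xy by metis
    have "m' (m' (\<phi> x) (\<phi> e)) (\<phi> y) \<in> X'.E \<longleftrightarrow> m (m x e) y \<in> X.E" if "e \<in> X.E" for e
      using phi_mult phi_E X.m_closed xy X.E_A[OF that] by metis
    then show "(\<forall>e\<in>X'.E. m' (m' (\<phi> x) e) (\<phi> y) \<in> X'.E) \<longleftrightarrow> (\<forall>e\<in>X.E. m (m x e) y \<in> X.E)"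
      unfolding E'_eq by blast
  qed
  show ?thesis
    unfolding normal_pair_def ball_conj_distrib
    using 1[OF assms] 1[OF assms(2,1)] 2[OF assms] 2[OF assms(2,1)] 3[OF assms] 3[OF assms(2,1)]
      phi_A assms by simp
qed

lemma phi_I: assumes "a \<in> A" shows "\<phi> a \<in> X'.I \<longleftrightarrow> a \<in> X.I"
proof
  assume "\<phi> a \<in> X'.I"
  then obtain b where b: "X'.R (\<phi> a) b" unfolding regular_normalizers_def by blast
  then have "b \<in> A'" by (simp add: normal_pair_def)
  then obtain a' where "b = \<phi> a'" "a' \<in> A" using phi_surj by blast
  then show "a \<in> X.I" using phi_R[OF assms] b unfolding regular_normalizers_def by blast
next
  assume "a \<in> X.I"
  then obtain a' where "X.R a a'" unfolding regular_normalizers_def by blast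
  moreover then have "a' \<in> A" by (simp add: normal_pair_def)
  ultimately show "\<phi> a \<in> X'.I" using phi_R[OF assms] unfolding regular_normalizers_def by blast
qed

lemma I'_eq: "X'.I = \<phi> ` X.I"
  using phi_I phi_surj X'.I_A X.I_A by blast

text \<open>The empty function is the zero of the semigroup.\<close>

lemma phi_empty: assumes "a \<in> A" shows "\<phi> a = Map.empty \<longleftrightarrow> a = Map.empty"
proof -
  obtain z where z: "z \<in> A" "\<phi> z = Map.empty" using X'.empty_A phi_surj by (metis imageE)
  have "\<phi> (m z Map.empty) = Map.empty"
    using phi_mult[OF z(1) X.empty_A] z X'.empty_zero(1)[OF phi_A[OF X.empty_A]] by simp
  then have "\<phi> Map.empty = Map.empty" using X.empty_zero(2)[OF z(1)] by simp
  then show ?thesis using phi_inj[OF assms X.empty_A] by metis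
qed

lemma phi_dom_subset:
  assumes "a \<in> X.I" "b \<in> X.I" "dom a \<subseteq> dom b" shows "dom (\<phi> a) \<subseteq> dom (\<phi> b)"
proof -
  obtain d where d: "d \<in> X.D" "a = m d b" using X.I_dom_subset_iff assms by blast
  have A: "a \<in> A" "b \<in> A" "d \<in> A" using assms X.I_A X.D_A d by blast+
  have "\<phi> d \<in> X'.D" "\<phi> a = m' (\<phi> d) (\<phi> b)" using phi_D phi_mult A d by auto
  then show ?thesis using X'.I_dom_subset_iff phi_I assms A by blast
qed

text \<open>The domains \<open>dom (\<phi> a)\<close> for \<open>a\<close> defined at \<open>g\<close> are compact and nonempty, and directed because the
  domains of the \<open>a\<close> form a basis and \<open>\<phi>\<close> respects inclusion. \<open>G'\<close> itself may fail to be
  Hausdorff, so the family is restricted to the members inside a fixed \<open>dom (\<phi> p)\<close>, which is a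
  bisection and therefore Hausdorff.\<close>

lemma ex_point_subset:
  assumes "g \<in> arrows G"
  shows "\<exists>g'\<in>arrows G'. \<forall>a\<in>X.I. g \<in> dom a \<longrightarrow> g' \<in> dom (\<phi> a)"
proof -
  obtain p where p: "p \<in> X.I" "g \<in> dom p" using X.I_nhd[OF X.open_arrows assms] by blast
  have p': "\<phi> p \<in> X'.I" using phi_I[OF X.I_A[OF p(1)]] p by simp
  define K where "K = subtopology X'.T (dom (\<phi> p))"
  have tp: "topspace K = dom (\<phi> p)"
    using X'.openin_arrows[OF X'.I_open[OF p']] by (auto simp: K_def X'.topspace_gtop)
  have comp: "compact_space K"
    unfolding K_def using X'.I_compact[OF p'] compact_space_subtopology by blast
  have haus: "Hausdorff_space K"
    unfolding K_def
    using X'.bisection_Hausdorff[OF X'.Hausdorff_units X'.I_open[OF p'] X'.I_bisection[OF p']] .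
  define F where "F = {a \<in> X.I. g \<in> dom a \<and> dom a \<subseteq> dom p}"
  have F_dir: "\<exists>b\<in>F. dom (\<phi> b) \<subseteq> dom (\<phi> a) \<inter> dom (\<phi> a')"
    if a: "a \<in> X.I" "g \<in> dom a" "a' \<in> X.I" "g \<in> dom a'" "dom a' \<subseteq> dom p" for a a'
  proof -
    have "openin X.T (dom a \<inter> dom a')" using X.I_open a by blast
    then obtain b where b: "b \<in> X.I" "g \<in> dom b" "dom b \<subseteq> dom a \<inter> dom a'"
      using X.I_nhd a by blast
    have "dom (\<phi> b) \<subseteq> dom (\<phi> a)" "dom (\<phi> b) \<subseteq> dom (\<phi> a')"
      using b phi_dom_subset[OF b(1) a(1)] phi_dom_subset[OF b(1) a(3)] by blast+
    moreover have "b \<in> F" using b a(5) unfolding F_def by blast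
    ultimately show ?thesis by blast
  qed
  define \<U> where "\<U> = (\<lambda>a. dom (\<phi> a)) ` F"
  have "closedin K C" if C: "C \<in> \<U>" for C
  proof -
    obtain a where a: "a \<in> F" "C = dom (\<phi> a)" using C unfolding \<U>_def by blast
    have I: "a \<in> X.I" "dom a \<subseteq> dom p" using a F_def by auto
    have "compactin X'.T C" using X'.I_compact phi_I[OF X.I_A] I a by blast
    moreover have "C \<subseteq> dom (\<phi> p)" using phi_dom_subset I p a by blast
    ultimately have "compactin K C" by (simp add: K_def compactin_subtopology)
    then show ?thesis using compactin_imp_closedin haus by blast
  qed
  moreover have "\<Inter>\<F> \<noteq> {}" if fin: "finite \<F>" and sub: "\<F> \<subseteq> \<U>" for \<F>
  proof -
    have "\<exists>b\<in>F. dom (\<phi> b) \<subseteq> \<Inter>\<F>" using fin sub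
    proof (induction \<F>)
      case empty
      have "p \<in> F" using p F_def by blast
      then show ?case by blast
    next
      case (insert C \<F>)
      then obtain b where b: "b \<in> F" "dom (\<phi> b) \<subseteq> \<Inter>\<F>" by blast
      obtain a where a: "a \<in> F" "C = dom (\<phi> a)" using insert.prems \<U>_def by blast
      obtain b' where "b' \<in> F" "dom (\<phi> b') \<subseteq> dom (\<phi> a) \<inter> dom (\<phi> b)"
        using F_dir[of a b] a b unfolding F_def by blast
      then show ?case using a b by blast
    qed
    then obtain b where b: "b \<in> F" "dom (\<phi> b) \<subseteq> \<Inter>\<F>" by blast
    then have "b \<in> A" "b \<noteq> Map.empty" using X.I_A F_def by auto
    then have "dom (\<phi> b) \<noteq> {}" using phi_empty by simp
    then show ?thesis using b by blast
  qed
  ultimately have "(\<forall>C\<in>\<U>. closedin K C) \<and> (\<forall>\<F>. finite \<F> \<and> \<F> \<subseteq> \<U> \<longrightarrow> \<Inter>\<F> \<noteq> {})"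
    by blast
  then have "\<Inter>\<U> \<noteq> {}"
    by (rule comp[unfolded compact_space_fip, THEN spec, THEN mp])
  then obtain g' where g': "g' \<in> \<Inter>\<U>" by blast
  have "g' \<in> dom (\<phi> a)" if a: "a \<in> X.I" "g \<in> dom a" for a
  proof -
    obtain b where "b \<in> F" "dom (\<phi> b) \<subseteq> dom (\<phi> a)" using F_dir[OF a p subset_refl] by blast
    then show ?thesis using g' \<U>_def by blast
  qed
  moreover have "g' \<in> arrows G'"
    using calculation[OF p] X'.dom_arrows[OF X'.I_A[OF p']] by blast
  ultimately show ?thesis by blast
qed

text \<open>Passing to \<open>G'\<close> and back gives an arrow \<open>h\<close> lying in every domain that contains \<open>g\<close>; by
  separation \<open>h = g\<close>, which turns the inclusions into equivalences.\<close>

lemma ex_point: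
  assumes "g \<in> arrows G"
  shows "\<exists>g'\<in>arrows G'. \<forall>a\<in>X.I. g \<in> dom a \<longleftrightarrow> g' \<in> dom (\<phi> a)"
proof -
  interpret flip: bumpy_iso G' c' Y' A' m' G c Y A m "inv_into A \<phi>" by (rule flip)
  obtain g' where g': "g' \<in> arrows G'" "\<And>a. a \<in> X.I \<Longrightarrow> g \<in> dom a \<Longrightarrow> g' \<in> dom (\<phi> a)"
    using ex_point_subset[OF assms] by blast
  obtain h where h: "h \<in> arrows G" "\<And>b. b \<in> X'.I \<Longrightarrow> g' \<in> dom b \<Longrightarrow> h \<in> dom (inv_into A \<phi> b)"
    using flip.ex_point_subset[OF g'(1)] by blast
  have h2: "h \<in> dom a" if "a \<in> X.I" "g' \<in> dom (\<phi> a)" for a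
    using h(2)[of "\<phi> a"] that phi_I[OF X.I_A[OF that(1)]] inv_phi[OF X.I_A[OF that(1)]] by simp
  have "h = g"
  proof (rule ccontr)
    assume "h \<noteq> g"
    then obtain a where "a \<in> X.I" "g \<in> dom a" "h \<notin> dom a"
      using X.I_separates[OF assms h(1)] by metis
    then show False using g'(2) h2 by blast
  qed
  then show ?thesis using g' h2 by blast
qed

definition point_map :: "'a \<Rightarrow> 'b" where
  "point_map g = (SOME g'. g' \<in> arrows G' \<and> (\<forall>a\<in>X.I. g \<in> dom a \<longleftrightarrow> g' \<in> dom (\<phi> a)))"

lemma point_map:
  assumes "g \<in> arrows G"
  shows "point_map g \<in> arrows G'" "\<And>a. a \<in> X.I \<Longrightarrow> point_map g \<in> dom (\<phi> a) \<longleftrightarrow> g \<in> dom a"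
proof -
  have "point_map g \<in> arrows G' \<and> (\<forall>a\<in>X.I. g \<in> dom a \<longleftrightarrow> point_map g \<in> dom (\<phi> a))"
    unfolding point_map_def by (rule someI_ex) (use ex_point[OF assms] in blast)
  then show "point_map g \<in> arrows G'" "\<And>a. a \<in> X.I \<Longrightarrow> point_map g \<in> dom (\<phi> a) \<longleftrightarrow> g \<in> dom a"
    by blast+
qed

lemma point_map_eqI:
  assumes "g \<in> arrows G" "g' \<in> arrows G'"
    and "\<And>a. a \<in> X.I \<Longrightarrow> g' \<in> dom (\<phi> a) \<Longrightarrow> g \<in> dom a"
  shows "point_map g = g'"
proof (rule ccontr)
  assume "point_map g \<noteq> g'"
  then obtain b where b: "b \<in> X'.I" "g' \<in> dom b" "point_map g \<notin> dom b"
    using X'.I_separates[OF assms(2) point_map(1)[OF assms(1)]] by metis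
  then obtain a where a: "a \<in> X.I" "b = \<phi> a" unfolding I'_eq by blast
  then show False using b assms(3) point_map(2)[OF assms(1)] by blast
qed

lemma point_map_surj: assumes "g' \<in> arrows G'" shows "\<exists>g\<in>arrows G. point_map g = g'"
proof -
  interpret flip: bumpy_iso G' c' Y' A' m' G c Y A m "inv_into A \<phi>" by (rule flip)
  obtain h where h: "h \<in> arrows G" "\<And>b. b \<in> X'.I \<Longrightarrow> g' \<in> dom b \<Longrightarrow> h \<in> dom (inv_into A \<phi> b)"
    using flip.ex_point_subset[OF assms] by blast
  have "h \<in> dom a" if "a \<in> X.I" "g' \<in> dom (\<phi> a)" for a
    using h(2)[of "\<phi> a"] that phi_I[OF X.I_A[OF that(1)]] inv_phi[OF X.I_A[OF that(1)]]
    by simp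
  then show ?thesis using point_map_eqI[OF h(1) assms] h(1) by blast
qed

lemma point_map_bij: "bij_betw point_map (arrows G) (arrows G')"
  unfolding bij_betw_def
proof
  show "inj_on point_map (arrows G)"
  proof (rule inj_onI, rule ccontr)
    fix g h assume gh: "g \<in> arrows G" "h \<in> arrows G" "point_map g = point_map h" "g \<noteq> h"
    obtain a where "a \<in> X.I" "g \<in> dom a" "h \<notin> dom a" using X.I_separates[OF gh(1,2,4)] .
    then show False using point_map(2) gh by metis
  qed
  show "point_map ` arrows G = arrows G'" using point_map(1) point_map_surj by blast
qed

lemma point_map_homeomorphic: "homeomorphic_map (gtop G) (gtop G') point_map"
proof (rule bijective_open_imp_homeomorphic_map)
  show "point_map ` topspace X.T = topspace X'.T" "inj_on point_map (topspace X.T)"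
    using point_map_bij by (simp_all add: bij_betw_def X.topspace_gtop X'.topspace_gtop)
  show "open_map X.T X'.T point_map"
    unfolding open_map_def
  proof (intro allI impI)
    fix U assume U: "openin X.T U"
    show "openin X'.T (point_map ` U)"
    proof (rule X'.openin_nhdI)
      fix g' assume "g' \<in> point_map ` U"
      then obtain g where g: "g \<in> U" "g' = point_map g" by blast
      obtain a where a: "a \<in> X.I" "g \<in> dom a" "dom a \<subseteq> U" using X.I_nhd[OF U g(1)] .
      have I': "\<phi> a \<in> X'.I" using a I'_eq by blast
      have "g' \<in> dom (\<phi> a)" using point_map(2)[OF _ a(1)] a g X.openin_arrows[OF U] by blast
      moreover have "dom (\<phi> a) \<subseteq> point_map ` U"
      proof
        fix h' assume h': "h' \<in> dom (\<phi> a)"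
        then obtain h where h: "h \<in> arrows G" "point_map h = h'"
          using point_map_surj X'.dom_arrows[OF X'.I_A[OF I']] by blast
        then have "h \<in> dom a" using point_map(2)[OF h(1) a(1)] h' by simp
        then show "h' \<in> point_map ` U" using a h by blast
      qed
      ultimately show "\<exists>B. openin X'.T B \<and> g' \<in> B \<and> B \<subseteq> point_map ` U"
        using X'.I_open[OF I'] by blast
    qed
  qed
  have "openin X.T {g \<in> arrows G. point_map g \<in> U}" if U: "openin X'.T U" for U
  proof (rule X.openin_nhdI)
    fix g assume g: "g \<in> {g \<in> arrows G. point_map g \<in> U}"
    then obtain b where b: "b \<in> X'.I" "point_map g \<in> dom b" "dom b \<subseteq> U"
      using X'.I_nhd[OF U] by blast
    then obtain a where a: "a \<in> X.I" "b = \<phi> a" unfolding I'_eq by blast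
    have "g \<in> dom a" using point_map(2)[OF _ a(1)] a b g by blast
    moreover have "dom a \<subseteq> {g \<in> arrows G. point_map g \<in> U}"
      using point_map(2)[OF _ a(1)] X.dom_arrows[OF X.I_A[OF a(1)]] a b by blast
    ultimately show "\<exists>B. openin X.T B \<and> g \<in> B \<and> B \<subseteq> {g \<in> arrows G. point_map g \<in> U}"
      using X.I_open[OF a(1)] by blast
  qed
  moreover have "point_map ` topspace X.T \<subseteq> topspace X'.T"
    using point_map_bij by (simp add: bij_betw_def X.topspace_gtop X'.topspace_gtop)
  ultimately show "continuous_map X.T X'.T point_map"
    unfolding continuous_map X.topspace_gtop X'.topspace_gtop by blast
qed

lemma point_map_composable:
  assumes "g \<in> arrows G" "h \<in> arrows G"
  shows "src G g = rng G h \<longleftrightarrow> src G' (point_map g) = rng G' (point_map h)"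
proof -
  have "src G' (point_map g) = rng G' (point_map h) \<longleftrightarrow> (\<forall>a\<in>X.I. \<forall>b\<in>X.I. g \<in> dom a \<longrightarrow>
      h \<in> dom b \<longrightarrow> m' (\<phi> a) (\<phi> b) \<noteq> Map.empty)"
    unfolding X'.composable_iff[OF point_map(1)[OF assms(1)] point_map(1)[OF assms(2)]] I'_eq
    using point_map(2)[OF assms(1)] point_map(2)[OF assms(2)] by simp
  also have "\<dots> \<longleftrightarrow> (\<forall>a\<in>X.I. \<forall>b\<in>X.I. g \<in> dom a \<longrightarrow> h \<in> dom b \<longrightarrow> m a b \<noteq> Map.empty)"
    using phi_empty phi_mult X.m_closed X.I_A by metis
  finally show ?thesis using X.composable_iff[OF assms] by blast
qed

text \<open>A basic neighbourhood of the product of the images contains a product \<open>dom (\<phi> x) dom (\<phi> y)\<close> of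
  neighbourhoods of the factors, and \<open>xy\<close> is a regular normalizer defined at \<open>gh\<close>.\<close>

lemma point_map_gmult:
  assumes "g \<in> arrows G" "h \<in> arrows G" "src G g = rng G h"
  shows "point_map (gmult G g h) = gmult G' (point_map g) (point_map h)"
proof (rule point_map_eqI)
  note arr' = point_map(1)[OF assms(1)] point_map(1)[OF assms(2)]
  have s': "src G' (point_map g) = rng G' (point_map h)" using point_map_composable assms by blast
  show gh: "gmult G g h \<in> arrows G" using X.gmult_closed assms by blast
  show "gmult G' (point_map g) (point_map h) \<in> arrows G'" using X'.gmult_closed arr' s' by blast
  fix a assume a: "a \<in> X.I" "gmult G' (point_map g) (point_map h) \<in> dom (\<phi> a)"
  have I': "\<phi> a \<in> X'.I" using a I'_eq by blast
  obtain N M where NM: "openin X'.T N" "openin X'.T M" "point_map g \<in> N" "point_map h \<in> M"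
    "set_gmult G' N M \<subseteq> dom (\<phi> a)"
    using X'.gmult_nhds[OF X'.I_open[OF I'] arr' s' a(2)] .
  obtain x where x: "x \<in> X.I" "point_map g \<in> dom (\<phi> x)" "dom (\<phi> x) \<subseteq> N"
    using X'.I_nhd[OF NM(1,3)] unfolding I'_eq by blast
  obtain y where y: "y \<in> X.I" "point_map h \<in> dom (\<phi> y)" "dom (\<phi> y) \<subseteq> M"
    using X'.I_nhd[OF NM(2,4)] unfolding I'_eq by blast
  have "g \<in> dom x" "h \<in> dom y" using x y point_map(2) assms by blast+
  then have "gmult G g h \<in> dom (m x y)"
    using X.I_dom_mult[OF x(1) y(1)] assms(3) by (auto simp: X.set_gmult_iff)
  then have "point_map (gmult G g h) \<in> dom (m' (\<phi> x) (\<phi> y))"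
    using point_map(2)[OF gh X.I_mult[OF x(1) y(1)]] phi_mult X.I_A x y by metis
  moreover have "dom (m' (\<phi> x) (\<phi> y)) \<subseteq> set_gmult G' N M"
    using X'.I_dom_mult[of "\<phi> x" "\<phi> y"] I'_eq x y unfolding set_gmult_def by blast
  ultimately have "point_map (gmult G g h) \<in> dom (\<phi> a)" using NM by blast
  then show "gmult G g h \<in> dom a" using point_map(2)[OF gh a(1)] by blast
qed

lemma isomorphic:
  "groupoid_iso G G' point_map" "homeomorphic_map (gtop G) (gtop G') point_map"
  using point_map_bij point_map_composable point_map_gmult point_map_homeomorphic
  unfolding groupoid_iso_def by blast+

end

theorem corollary9p6:
  fixes G :: "'a top_groupoid" and G' :: "'b top_groupoid" and \<Gamma> :: "'k groupoid"
    and c :: "'a \<Rightarrow> 'k" and c' :: "'b \<Rightarrow> 'k"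
    and Y :: "'y semigroupoid" and Y' :: "'z semigroupoid"
    and A :: "('a \<rightharpoonup> 'y) set" and A' :: "('b \<rightharpoonup> 'z) set"
    and m :: "('a \<rightharpoonup> 'y) \<Rightarrow> ('a \<rightharpoonup> 'y) \<Rightarrow> ('a \<rightharpoonup> 'y)"
    and m' :: "('b \<rightharpoonup> 'z) \<Rightarrow> ('b \<rightharpoonup> 'z) \<Rightarrow> ('b \<rightharpoonup> 'z)"
  assumes "top_groupoid G" and "top_groupoid G'" and "groupoid \<Gamma>"
    and "Hausdorff_space (subtopology (gtop G) (units G))"
    and "Hausdorff_space (subtopology (gtop G') (units G'))"
    and "grading G \<Gamma> c" and "grading G' \<Gamma> c'"
    and "indecomposable_semigroupoid Y" and "indecomposable_semigroupoid Y'"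
    and "pfun_semigroup G c Y A m" and "pfun_semigroup G' c' Y' A' m'"
    and "\<And>a b. \<lbrakk>a \<in> N_of G A; b \<in> N_of G A\<rbrakk> \<Longrightarrow> dom (m a b) \<subseteq> set_gmult G (dom a) (dom b)"
    and "\<And>a b. \<lbrakk>a \<in> N_of G' A'; b \<in> N_of G' A'\<rbrakk> \<Longrightarrow> dom (m' a b) \<subseteq> set_gmult G' (dom a) (dom b)"
    and "exhaustive G Y (D_of G A)" and "exhaustive G' Y' (D_of G' A')"
    and "compact_bumpy G c Y (S_of G A)" and "compact_bumpy G' c' Y' (S_of G' A')"
    and "ample G" and "ample G'"
    and "CRZ_of G Y A m \<subseteq> S_of G A" and "CRZ_of G' Y' A' m' \<subseteq> S_of G' A'"
    and "\<exists>\<phi>. semigroup_iso A m A' m' \<phi> \<and> graded_map c c' A \<phi> \<and> \<phi> ` D_of G A = D_of G' A'"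
  shows "etale G \<and> etale G' \<and>
    (\<exists>\<psi>. groupoid_iso G G' \<psi> \<and> homeomorphic_map (gtop G) (gtop G') \<psi>)"
proof -
  interpret X: bumpy_semigroup G c Y A m
    by (intro bumpy_semigroup.intro ample_groupoid.intro ample_groupoid_axioms.intro
        bumpy_semigroup_axioms.intro assms)
  interpret X': bumpy_semigroup G' c' Y' A' m'
    by (intro bumpy_semigroup.intro ample_groupoid.intro ample_groupoid_axioms.intro
        bumpy_semigroup_axioms.intro assms)
  obtain \<phi> where "semigroup_iso A m A' m' \<phi>" "\<phi> ` D_of G A = D_of G' A'"
    using assms(22) by blast
  then interpret bumpy_iso G c Y A m G' c' Y' A' m' \<phi>
    by unfold_locales
  show ?thesis using X.etale X'.etale isomorphic by blast
qed

end
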